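(* The space $JT_G$ is not reflexive. In particular, for every infinite subset $N$ of $\mathbb N$, the closed subspace $X_N$ of $JT_G$ generated by the subsequence $(e_n)_{n\in N}$ of the basis $(e_n)_{n\in\mathbb N}$ contains a subspace isomorphic to $c_0$.
   Context: Schreier families: for finite sets, $F<G$ means $\max F<\min G$. $\mathcal S_1=\{F\subset\mathbb N:\#F\le\min F\}$ (with $\emptyset\in\mathcal S_1$), and $\mathcal S_{n+1}=\{\bigcup_{i=1}^dF_i: F_1<\dots<F_d,\ F_i\in\mathcal S_n,\ d\le\min F_1\}$ (together with $\emptyset$). Repeated averages: for infinite $L=\{l_1<l_2<\dots\}\subset\mathbb N$, let $\alpha_k(0,L)=e_{l_k}$. Inductively $\alpha_1(n+1,L)=\frac1{l_1}\sum_{i=1}^{l_1}\alpha_i(n,L)$ and $\alpha_k(n+1,L)=\alpha_1(n+1,L_k)$, where $L_k=L\setminus\bigcup_{i<k}\operatorname{supp}\alpha_i(n+1,L)$. For $n\ge1$ the support of $\alpha_1(n,L)$ is the largest initial segment of $L$ belonging to $\mathcal S_n$, and $\alpha_1(n,L)$ has nonnegative coordinates with sum $1$. $S^{(2)}$ is the completion of $c_{00}(\mathbb N)$ under $\|x\|_{S^{(2)}}=\sup_{F\in\mathcal S_1}(\sum_{i\in F}x(i)^2)^{1/2}$. Tree: fix strictly increasing sequences $(m_j)_{j\in\mathbb N},(n_j)_{j\in\mathbb N}$ of positive integers with $m_j\le n_j$, and a strictly increasing $\gamma:\mathbb N\cup\{\emptyset\}\to\mathbb N$, where $\gamma(\emptyset)<\gamma(n)$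 for all $n\in\mathbb N$. $\mathcal T$ is a tree with root $\emptyset$ whose other nodes form an infinite set $D\subset\mathbb N$; its order is compatible with the usual order on $D$ ($m\preceq n$ implies $m\le n$), the predecessors of each node are linearly ordered, every node (including $\emptyset$) has infinitely many immediate successors, and for every node $n$ (including $\emptyset$) every immediate successor of $n$ is larger than $(3m_{2\gamma(n)+1}^2)^2$. A segment is a set $\{k\in D:m\preceq k\preceq n\}$ with $m\preceq n$ in $D$; a branch is a maximal linearly ordered subset of $D$. Functionals: for each branch $\sigma$, define successive $s_k^\sigma\subset\sigma$ inductively: $j_1=\gamma(\emptyset)$, $j_k=\gamma(\max s_{k-1}^\sigma)$ for $k\ge2$, and $s_k^\sigma$ is the largest initial segment of $\sigma\setminus\bigcup_{i<k}s_i^\sigma$ belonging to $\mathcal S_{n_{2j_k+1}}$. With $\beta_l\ge0$ given by $\beta_l^2=\alpha_1(n_{2j_k+1},\sigma\setminus\bigcup_{i<k}s_i^\sigma)(l)$ for $l\in s_k^\sigma$, put $x_k^\sigma=m_{2j_k+1}^2\sum_{l\in s_k^\sigma}\beta_le_l$ and $\phi_k^\sigma=m_{2j_k+1}^{-2}\sum_{l\in s_k^\sigma}\beta_le_l$, the latter acting on $c_{00}(\mathbb N)$ by the usual pairing. Let $W(\sigma)$ be the set of restrictions $(\sum_{i=1}^n\lambda_i\phi_i^\sigma)|_E$ with $n\in\mathbb N$, $\lambda_i\in\mathbb Q$, $\sum\lambda_i^2\le1$, $E$ an interval of $\mathbb N$, and let $\|x\|_\sigma=\sup\{f(x):f\in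 W(\sigma)\}$. For a segment $s$ let $\|x\|_s=\|x|_s\|_\sigma$ for any branch $\sigma\supset s$ (this does not depend on $\sigma$). $JT_G$ is the completion of $c_{00}(\mathbb N)$ under $$\|x\|=\max\Big\{\|x\|_\infty,\ \sup\Big\|\sum_{i=1}^n\|x\|_{s_i}e_{\min s_i}\Big\|_{S^{(2)}}\Big\},$$ the supremum over all finite families of pairwise disjoint segments $s_1,\dots,s_n$ with $\{\min s_i:i\le n\}\in\mathcal S_1$. $(e_n)_n$ is a Schauder basis of $JT_G$. *)

theory Defs
  imports "HOL-Analysis.Analysis"
begin

text \<open>
  Throughout, the set of positive integers is \<open>{1..}\<close> (of type \<^typ>\<open>nat set\<close>); the number
  \<open>0\<close> is not a coordinate index and is free to encode the root of the tree below.
\<close>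

section \<open>Schreier families and repeated averages\<close>

text \<open>For nonempty finite sets.\<close>

definition precedes :: "nat set \<Rightarrow> nat set \<Rightarrow> bool" where
  "precedes F G \<longleftrightarrow> Max F < Min G"

text \<open>The families are indexed from \<open>1\<close>; the value at \<open>0\<close> is never used.\<close>

fun schreier :: "nat \<Rightarrow> nat set set" where
  "schreier 0 = {{}}"
| "schreier (Suc 0) =
     insert {} {F. F \<subseteq> {1..} \<and> finite F \<and> F \<noteq> {} \<and> card F \<le> Min F}"
| "schreier (Suc (Suc k)) =
     insert {} {\<Union>i\<in>{1..d}. F i | d F.
       1 \<le> d \<and> (\<forall>i\<in>{1..d}. F i \<in> schreier (Suc k) \<and> F i \<noteq> {}) \<and>
       (\<forall>i\<in>{1..<d}. precedes (F i) (F (Suc i))) \<and> d \<le> Min (F 1)}"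

text \<open>
  \<open>rep_avg n k L\<close> is the vector \<open>\<alpha>\<^sub>k(n,L)\<close>, for infinite \<open>L \<subseteq> {1..}\<close> and \<open>k \<ge> 1\<close>. As \<^const>\<open>enumerate\<close>
  counts from \<open>0\<close>, the \<open>k\<close>-th element of \<open>L\<close> is \<open>enumerate L (k - 1)\<close>, and \<open>Inf L\<close> is the first.
\<close>

function rep_avg :: "nat \<Rightarrow> nat \<Rightarrow> nat set \<Rightarrow> nat \<Rightarrow> real" where
  "rep_avg 0 k L = (\<lambda>l. if l = enumerate L (k - 1) then 1 else 0)"
| "rep_avg (Suc n) k L =
     (if k \<le> 1 then (\<lambda>l. (\<Sum>i = 1..Inf L. rep_avg n i L l) / real (Inf L))
      else rep_avg (Suc n) 1 (L - (\<Union>i\<in>{1..<k}. {l. rep_avg (Suc n) i L l \<noteq> 0})))"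
  by pat_completeness auto
termination
  by (relation "measures [\<lambda>(n, k, L). n, \<lambda>(n, k, L). k]") auto

section \<open>Finitely supported sequences, norms, completions\<close>

definition c00 :: "(nat \<Rightarrow> real) set" where
  "c00 = {x. finite {i. x i \<noteq> 0} \<and> x 0 = 0}"

definition pairing :: "(nat \<Rightarrow> real) \<Rightarrow> (nat \<Rightarrow> real) \<Rightarrow> real" where
  "pairing f x = (\<Sum>i | x i \<noteq> 0. f i * x i)"

definition restr :: "(nat \<Rightarrow> real) \<Rightarrow> nat set \<Rightarrow> nat \<Rightarrow> real" where
  "restr x E = (\<lambda>i. if i \<in> E then x i else 0)"

text \<open>The norm of \<open>S\<^sup>(\<^sup>2\<^sup>)\<close> on \<^const>\<open>c00\<close>.\<close>

definition S2_norm :: "(nat \<Rightarrow> real) \<Rightarrow> real" where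
  "S2_norm x = (SUP F\<in>schreier 1. sqrt (\<Sum>i\<in>F. (x i)\<^sup>2))"

text \<open>
  The Banach space \<^typ>\<open>'b\<close> is a completion of \<^const>\<open>c00\<close> under the norm \<open>p\<close>, the isometric linear
  embedding with dense range being the one that sends the \<open>i\<close>-th unit vector to \<open>e i\<close>.
\<close>

definition completion_of_c00 :: "((nat \<Rightarrow> real) \<Rightarrow> real) \<Rightarrow> (nat \<Rightarrow> 'b::banach) \<Rightarrow> bool" where
  "completion_of_c00 p e \<longleftrightarrow>
     (\<forall>x\<in>c00. norm (\<Sum>i | x i \<noteq> 0. x i *\<^sub>R e i) = p x) \<and>
     closure (span (e ` {1..})) = UNIV"

section \<open>The tree and the norm of \<open>JT\<^sub>G\<close>\<close>

text \<open>
  The root is encoded by \<open>0\<close>, so the tree is \<open>insert 0 D\<close>, and \<open>\<gamma>\<close>, defined on the positive integers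
  together with the root, becomes a strictly increasing function on all of \<^typ>\<open>nat\<close>.
  The values \<open>m 0\<close> and \<open>n 0\<close> play no role.
\<close>

locale jt_tree =
  fixes m n :: "nat \<Rightarrow> nat"
    and \<gamma> :: "nat \<Rightarrow> nat"
    and D :: "nat set"
    and le :: "nat \<Rightarrow> nat \<Rightarrow> bool"  (infix \<open>\<preceq>\<close> 50)
  assumes m_strict: "strict_mono_on {1..} m"
    and n_strict: "strict_mono_on {1..} n"
    and m_pos_le_n: "\<And>j. 1 \<le> j \<Longrightarrow> 0 < m j \<and> m j \<le> n j"
    and \<gamma>_strict: "strict_mono \<gamma>"
    and \<gamma>_pos: "0 < \<gamma> 0"
    and D_pos: "D \<subseteq> {1..}"
    and D_infinite: "infinite D"
    and le_refl: "reflp_on (insert 0 D) (\<preceq>)"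
    and le_antisym: "antisymp_on (insert 0 D) (\<preceq>)"
    and le_trans: "transp_on (insert 0 D) (\<preceq>)"
    and root_le: "\<And>x. x \<in> insert 0 D \<Longrightarrow> 0 \<preceq> x"
    and le_compat: "\<And>x y. x \<in> D \<Longrightarrow> y \<in> D \<Longrightarrow> x \<preceq> y \<Longrightarrow> x \<le> y"
    and predecessors_chain:
      "\<And>x. x \<in> insert 0 D \<Longrightarrow> totalp_on {y \<in> insert 0 D. y \<preceq> x} (\<preceq>)"
    and infinite_succs:
      "\<And>p. p \<in> insert 0 D \<Longrightarrow>
        infinite {q \<in> insert 0 D. p \<preceq> q \<and> p \<noteq> q \<and>
          (\<forall>r\<in>insert 0 D. p \<preceq> r \<and> r \<preceq> q \<longrightarrow> r = p \<or> r = q)}"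
    and succs_large:
      "\<And>p q. p \<in> insert 0 D \<Longrightarrow> q \<in> insert 0 D \<Longrightarrow> p \<preceq> q \<Longrightarrow> p \<noteq> q \<Longrightarrow>
        (\<forall>r\<in>insert 0 D. p \<preceq> r \<and> r \<preceq> q \<longrightarrow> r = p \<or> r = q) \<Longrightarrow>
        (3 * (m (2 * \<gamma> p + 1))\<^sup>2)\<^sup>2 < q"

text \<open>In a set of finite sets, \<^const>\<open>Greatest\<close> refers to inclusion.\<close>

definition initial_segment :: "nat set \<Rightarrow> nat set \<Rightarrow> bool" where
  "initial_segment I A \<longleftrightarrow> I \<subseteq> A \<and> (\<forall>x\<in>I. \<forall>y\<in>A. y \<le> x \<longrightarrow> y \<in> I)"

definition nat_interval :: "nat set \<Rightarrow> bool" where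
  "nat_interval E \<longleftrightarrow> (\<forall>a\<in>E. \<forall>b\<in>E. {a..b} \<subseteq> E)"

context jt_tree
begin

definition segment :: "nat set \<Rightarrow> bool" where
  "segment s \<longleftrightarrow> (\<exists>a\<in>D. \<exists>b\<in>D. a \<preceq> b \<and> s = {k \<in> D. a \<preceq> k \<and> k \<preceq> b})"

definition branch :: "nat set \<Rightarrow> bool" where
  "branch \<sigma> \<longleftrightarrow> \<sigma> \<subseteq> D \<and> totalp_on \<sigma> (\<preceq>) \<and>
     (\<forall>\<tau>. \<sigma> \<subseteq> \<tau> \<and> \<tau> \<subseteq> D \<and> totalp_on \<tau> (\<preceq>) \<longrightarrow> \<tau> = \<sigma>)"

text \<open>
  With the convention \<open>s\<^sub>0 = {}\<close>, the number \<open>2j\<^sub>k + 1\<close> is \<open>next_index s\<^sub>k\<^sub>-\<^sub>1\<close> for every \<open>k \<ge> 1\<close>.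
\<close>

definition next_index :: "nat set \<Rightarrow> nat" where
  "next_index s = 2 * \<gamma> (if s = {} then 0 else Max s) + 1"

fun blk :: "nat set \<Rightarrow> nat \<Rightarrow> nat set" where
  "blk \<sigma> 0 = {}"
| "blk \<sigma> (Suc k) =
     (GREATEST I. initial_segment I (\<sigma> - (\<Union>i\<in>{1..k}. blk \<sigma> i)) \<and>
        I \<in> schreier (n (next_index (blk \<sigma> k))))"

text \<open>The coefficient sequence of \<open>\<phi>\<^sub>k\<^sup>\<sigma>\<close>, for \<open>k \<ge> 1\<close>.\<close>

definition \<phi> :: "nat set \<Rightarrow> nat \<Rightarrow> nat \<Rightarrow> real" where
  "\<phi> \<sigma> k = (let r = next_index (blk \<sigma> (k - 1)) in
     (\<lambda>l. if l \<in> blk \<sigma> k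
          then sqrt (rep_avg (n r) 1 (\<sigma> - (\<Union>i\<in>{1..<k}. blk \<sigma> i)) l) / (real (m r))\<^sup>2
          else 0))"

definition W :: "nat set \<Rightarrow> (nat \<Rightarrow> real) set" where
  "W \<sigma> = {restr (\<lambda>l. \<Sum>i = 1..N. c i * \<phi> \<sigma> i l) E | N c E.
     1 \<le> N \<and> (\<forall>i\<in>{1..N}. c i \<in> \<rat>) \<and> (\<Sum>i = 1..N. (c i)\<^sup>2) \<le> 1 \<and> nat_interval E}"

definition branch_norm :: "nat set \<Rightarrow> (nat \<Rightarrow> real) \<Rightarrow> real" where
  "branch_norm \<sigma> x = (SUP f\<in>W \<sigma>. pairing f x)"

text \<open>The value does not depend on which branch containing \<open>s\<close> is chosen.\<close>

definition segment_norm :: "nat set \<Rightarrow> (nat \<Rightarrow> real) \<Rightarrow> real" where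
  "segment_norm s x = branch_norm (SOME \<sigma>. branch \<sigma> \<and> s \<subseteq> \<sigma>) (restr x s)"

definition admissible :: "nat set set \<Rightarrow> bool" where
  "admissible \<S> \<longleftrightarrow> finite \<S> \<and> (\<forall>s\<in>\<S>. segment s) \<and> pairwise disjnt \<S> \<and>
     Min ` \<S> \<in> schreier 1"

definition jt_norm :: "(nat \<Rightarrow> real) \<Rightarrow> real" where
  "jt_norm x = max (SUP i. \<bar>x i\<bar>)
     (SUP \<S>\<in>{\<S>. admissible \<S>}.
        S2_norm (\<lambda>i. \<Sum>s\<in>\<S>. segment_norm s x * (if i = Min s then 1 else 0)))"

end

section \<open>Banach space notions\<close>

definition canonical_embedding ::
    "'b::real_normed_vector \<Rightarrow> (('b \<Rightarrow>\<^sub>L real) \<Rightarrow>\<^sub>L real)" where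
  "canonical_embedding x = Blinfun (\<lambda>f. blinfun_apply f x)"

lemma canonical_embedding_apply [simp]:
  "blinfun_apply (canonical_embedding x) f = blinfun_apply f x"
  unfolding canonical_embedding_def
  by (rule bounded_linear_Blinfun_apply[THEN fun_cong])
     (rule blinfun.bounded_linear_left)

definition reflexive_space :: "'b::real_normed_vector itself \<Rightarrow> bool" where
  "reflexive_space _ \<longleftrightarrow> surj (canonical_embedding :: 'b \<Rightarrow> _)"

text \<open>As a subspace of \<open>\<ell>\<^sub>\<infinity>\<close>, that is, of the bounded functions on the discrete space \<^typ>\<open>nat\<close>.\<close>

definition c0 :: "(nat \<Rightarrow>\<^sub>C real) set" where
  "c0 = {f. apply_bcontfun f \<longlonglongrightarrow> 0}"

text \<open>Isomorphism of normed spaces, for linear subspaces of possibly different spaces.\<close>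

definition isomorphic_subspaces ::
    "'a::real_normed_vector set \<Rightarrow> 'b::real_normed_vector set \<Rightarrow> bool" where
  "isomorphic_subspaces U V \<longleftrightarrow> subspace U \<and> subspace V \<and>
     (\<exists>T S. homeomorphism U V T S \<and>
        (\<forall>x\<in>U. \<forall>y\<in>U. T (x + y) = T x + T y) \<and>
        (\<forall>a. \<forall>x\<in>U. T (a *\<^sub>R x) = a *\<^sub>R T x))"

end

(*
  By Ramsey's theorem N contains an infinite chain of the tree or an infinite set that meets every
  segment in at most one point. Along a chain the segment norms of the unit vectors tend to zero, as
  the denominators m_r^2 in the functionals grow. In the other case the norms of the sums of e_i over
  finite sets F either stay bounded, and then the e_i span c_0, or are unbounded, and then
  normalising such sums gives unit vectors with arbitrarily small segment norms. Successive unit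
  vectors u_k with rapidly decreasing segment norms span c_0: the minimum of an admissible family
  lies in the range of one u_j and bounds the size of the family, so that only u_j contributes
  substantially. The space is not reflexive, as f |-> sum_k f(u_k) is a bounded functional on the
  dual that is not an evaluation.
*)

theory Submission
  imports Defs "HOL-Library.Ramsey"
begin

section \<open>Schreier families\<close>

text \<open>Only the upper c_0 estimate is hard. The lower one comes from \<open>W\<close> being
  stable under restriction to intervals, which makes interval projections contractions. The obstacle
  along a chain is that \<open>segment_norm\<close> evaluates on a branch picked by choice, so a
  decay estimate has to hold for every branch through a given point. Two facts give this uniformity.
  The tree order fixes the part of a branch up to each of its points. Schreier families are compact:
  some finite initial part of an infinite set fits into no member. Hence the largest Schreier
  initial segment exists and depends on finitely many elements only, and branches that agree long
  enough share their first blocks; a late common point lies in a late block. In the other case each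
  segment sees at most one coordinate, so on every segment a vector is a multiple of the indicator
  of its support; this is why bounded sums of unit vectors already control all coefficients. The
  constant 3 is 1 for the block containing the first minimum of the family, plus 2 for the geometric
  series over the remaining blocks.\<close>

lemma schreier_finite: "F \<in> schreier k \<Longrightarrow> finite F"
  by (induction k arbitrary: F rule: schreier.induct) auto

lemma schreier_singleton: "1 \<le> l \<Longrightarrow> {l} \<in> schreier (Suc k)"
proof (induction k)
  case (Suc k)
  have "{l} = (\<Union>i\<in>{1..1::nat}. {l})" by auto
  moreover have "(1::nat) \<le> Min {l}" using Suc by simp
  ultimately show ?case
    unfolding schreier.simps using Suc
    by (intro insertI2 CollectI exI[of _ 1] exI[of _ "\<lambda>_. {l}"]) auto
qed auto

lemma precedes_chain:
  fixes F :: "nat \<Rightarrow> nat set"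
  assumes fin: "\<And>i. i \<in> {1..d} \<Longrightarrow> finite (F i) \<and> F i \<noteq> {}"
    and prec: "\<And>i. i \<in> {1..<d} \<Longrightarrow> precedes (F i) (F (Suc i))"
    and "1 \<le> i" "i < j" "j \<le> d" "a \<in> F i" "b \<in> F j"
  shows "a < b"
  using assms(4,5,7)
proof (induction j arbitrary: b)
  case (Suc j)
  have *: "x < b" if "x \<in> F j" for x
  proof -
    have "x \<le> Max (F j)" using fin[of j] that Suc.prems assms(3) by auto
    also have "\<dots> < Min (F (Suc j))"
      using prec[of j] Suc.prems assms(3) by (auto simp: precedes_def)
    also have "\<dots> \<le> b" using fin[of "Suc j"] Suc.prems by auto
    finally show ?thesis .
  qed
  show ?case
  proof (cases "i = j")
    case True
    then show ?thesis using * assms by auto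
  next
    case False
    obtain y where "y \<in> F j" using fin[of j] Suc.prems assms(3) by fastforce
    then show ?thesis using Suc.IH[of y] *[of y] False Suc.prems by auto
  qed
qed auto

text \<open>Compactness in quantitative form, by induction on the family: a union of
  \<open>d\<close> pieces cannot swallow more consecutive windows than it has pieces, if no piece
  swallows a window.\<close>

lemma schreier_compact:
  assumes "infinite L" "L \<subseteq> {1..}"
  shows "\<exists>q. \<forall>F\<in>schreier k. \<not> L \<inter> {..q} \<subseteq> F"
  using assms
proof (induction k arbitrary: L rule: schreier.induct)
  case 1
  then obtain x where "x \<in> L" by fastforce
  then show ?case by auto
next
  case 2
  let ?l = "Inf L"
  have l: "?l \<in> L" using 2 Inf_nat_def1[of L] by (metis finite.emptyI)
  \<comment> \<open>A member of the first family whose minimum is at most \<open>?l\<close> has at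
    most \<open>?l\<close> elements, so one more is enough.\<close>
  obtain A where A: "A \<subseteq> L" "finite A" "card A = Suc ?l"
    using 2 infinite_arbitrarily_large by blast
  define q where "q = Max (insert ?l A)"
  have sub: "insert ?l A \<subseteq> L \<inter> {..q}" using A l by (auto simp: q_def)
  show ?case
  proof (intro exI[of _ q] ballI notI)
    fix F assume F: "F \<in> schreier (Suc 0)" and "L \<inter> {..q} \<subseteq> F"
    then have AF: "insert ?l A \<subseteq> F" using sub by auto
    then have "F \<noteq> {}" "finite F" using F schreier_finite by auto
    then have "card F \<le> Min F" using F by auto
    also have "\<dots> \<le> ?l" using AF \<open>finite F\<close> by auto
    also have "\<dots> < card A" using A by simp
    also have "\<dots> \<le> card F" using AF \<open>finite F\<close> by (intro card_mono) auto
    finally show False by simp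
  qed
next
  case (3 k)
  let ?l = "Inf L"
  have l: "?l \<in> L" using 3 Inf_nat_def1[of L] by (metis finite.emptyI)
  have inf: "infinite (L \<inter> {p<..})" for p
  proof
    assume "finite (L \<inter> {p<..})"
    then have "finite ((L \<inter> {p<..}) \<union> {..p})" by simp
    then show False using 3(2) by (meson finite_subset subsetI IntI UnCI greaterThan_iff atMost_iff not_le)
  qed
  have "\<forall>p. \<exists>q. \<forall>F\<in>schreier (Suc k). \<not> (L \<inter> {p<..}) \<inter> {..q} \<subseteq> F"
    using "3.IH"[OF _ inf, of 1] 3(3) by fastforce
  then obtain P where P: "\<And>p F. F \<in> schreier (Suc k) \<Longrightarrow> \<not> (L \<inter> {p<..}) \<inter> {..P p} \<subseteq> F"
    by metis
  \<comment> \<open>The points \<open>p j\<close> cut \<open>L\<close> into consecutive windows,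
    none of which fits into a member of the lower family. As \<open>F\<close> will contain the least
    element \<open>?l\<close>, it has at most \<open>?l\<close> pieces, so \<open>?l\<close> windows
    suffice.\<close>
  define p where "p j = (P ^^ j) 0" for j
  have p_Suc: "p (Suc j) = P (p j)" for j by (simp add: p_def)
  have "p j \<le> p (Suc j)" for j
  proof (rule ccontr)
    assume "\<not> p j \<le> p (Suc j)"
    then have "(L \<inter> {p j<..}) \<inter> {..P (p j)} = {}" by (auto simp: p_Suc)
    then show False using P[of "{1}" "p j"] schreier_singleton[of 1 k] by auto
  qed
  then have p_mono: "i \<le> j \<Longrightarrow> p i \<le> p j" for i j by (rule lift_Suc_mono_le)
  show ?case
  proof (intro exI[of _ "p ?l"] ballI notI)
    fix F assume F: "F \<in> schreier (Suc (Suc k))" and sub: "L \<inter> {..p ?l} \<subseteq> F"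
    have "(L \<inter> {p 0<..}) \<inter> {..p 1} \<noteq> {}"
      using P[of "{1}" "p 0"] schreier_singleton[of 1 k] by (auto simp: p_def)
    then obtain x where x: "x \<in> L" "x \<le> p 1" by auto
    have "?l \<le> x" using x(1) by (simp add: cInf_lower)
    moreover have "1 \<le> ?l" using l 3(3) by auto
    then have "p 1 \<le> p ?l" using p_mono by blast
    ultimately have lF: "?l \<in> F" using l sub x by auto
    then obtain d G where G: "F = (\<Union>i\<in>{1..d}. G i)" "1 \<le> d"
       "\<forall>i\<in>{1..d}. G i \<in> schreier (Suc k) \<and> G i \<noteq> {}"
       "\<forall>i\<in>{1..<d}. precedes (G i) (G (Suc i))" "d \<le> Min (G 1)"
      using F by auto
    have less: "a < b" if "1 \<le> i" "i < j" "j \<le> d" "a \<in> G i" "b \<in> G j" for i j a b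
      using precedes_chain[of d G i j a b] G that schreier_finite by blast
    have dl: "d \<le> ?l"
    proof -
      obtain i where i: "i \<in> {1..d}" "?l \<in> G i" using lF G by auto
      have "G 1 \<in> schreier (Suc k)" "G 1 \<noteq> {}" using G(2,3) by auto
      then have f: "finite (G 1)" "G 1 \<noteq> {}" using schreier_finite by blast+
      then have M: "Min (G 1) \<in> G 1" by simp
      have "Min (G 1) \<le> ?l"
        using i f less[of 1 i "Min (G 1)" ?l] M by (cases "i = 1") auto
      then show ?thesis using G by simp
    qed
    \<comment> \<open>Each window defeats one more piece. The old witness \<open>y\<close> lies in
      \<open>F\<close>, hence in a piece after the \<open>j\<close>-th; the new \<open>z\<close>
      avoids piece \<open>j + 1\<close> and exceeds \<open>y\<close>, so it avoids the earlier
      pieces too.\<close>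
    have "j \<le> d \<Longrightarrow> 1 \<le> j \<Longrightarrow> \<exists>y\<in>L. y \<le> p j \<and> (\<forall>i\<in>{1..j}. y \<notin> G i)" for j
    proof (induction j)
      case (Suc j)
      obtain z where z: "z \<in> L" "z > p j" "z \<le> p (Suc j)" "z \<notin> G (Suc j)"
        using P[of "G (Suc j)" "p j"] G(3) Suc.prems by (auto simp: p_Suc)
      show ?case
      proof (cases "j = 0")
        case True
        then show ?thesis using z by auto
      next
        case False
        then obtain y where y: "y \<in> L" "y \<le> p j" "\<forall>i\<in>{1..j}. y \<notin> G i"
          using Suc by auto
        have "p j \<le> p ?l" using p_mono[of j ?l] Suc.prems dl by simp
        then have "y \<in> F" using y sub by auto
        then obtain i where i: "i \<in> {1..d}" "y \<in> G i" using G by auto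
        then have "i > j" using y by (meson atLeastAtMost_iff not_le)
        then have "z \<notin> G i'" if "i' \<in> {1..j}" for i'
          using less[of i' i z y] that i y z by auto
        then have "\<forall>i\<in>{1..Suc j}. z \<notin> G i" using z by (auto simp: le_Suc_eq)
        then show ?thesis using z by blast
      qed
    qed auto
    from this[of d] obtain y where y: "y \<in> L" "y \<le> p d" "\<forall>i\<in>{1..d}. y \<notin> G i" using G by auto
    have "p d \<le> p ?l" using p_mono[of d ?l] dl by simp
    then show False using y sub G by auto
  qed
qed

text \<open>Averages of numbers in [0,1] stay there. This holds for every set \<open>L\<close>: if
  \<open>Inf L = 0\<close>, the sum is empty and division by zero yields 0.\<close>

lemma rep_avg_bounds: "0 \<le> rep_avg n k L l \<and> rep_avg n k L l \<le> 1"
proof (induction n k L rule: rep_avg.induct)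
  case (2 n k L)
  show ?case
  proof (cases "k \<le> 1")
    case True
    have "(\<Sum>i = 1..Inf L. rep_avg n i L l) \<le> (\<Sum>i = 1..Inf L. 1)"
      using 2(1)[OF True] by (intro sum_mono) auto
    moreover have "0 \<le> (\<Sum>i = 1..Inf L. rep_avg n i L l)"
      using 2(1)[OF True] by (intro sum_nonneg) auto
    ultimately show ?thesis using True by (simp add: divide_le_eq)
  next
    case False
    then show ?thesis using 2(3)[OF False] by simp
  qed
qed auto

lemma initial_segment_linear:
  assumes "initial_segment I L" "initial_segment J L"
  shows "I \<subseteq> J \<or> J \<subseteq> I"
proof (rule ccontr)
  assume "\<not> ?thesis"
  then obtain x y where "x \<in> I" "x \<notin> J" "y \<in> J" "y \<notin> I" by blast
  then show False using assms linear[of x y] unfolding initial_segment_def by blast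
qed

lemma initial_segment_bounded:
  assumes "initial_segment I L" "\<not> L \<inter> {..q} \<subseteq> I"
  shows "I \<subseteq> {..<q}"
proof
  obtain z where z: "z \<in> L" "z \<le> q" "z \<notin> I" using assms by auto
  fix x assume "x \<in> I"
  then have "\<not> z \<le> x" using assms z unfolding initial_segment_def by blast
  then show "x \<in> {..<q}" using z by simp
qed

text \<open>By compactness all candidates lie below one bound, so there are finitely many. Initial
  segments are comparable under inclusion, so a maximal candidate is the greatest one and the
  \<open>GREATEST\<close> term is meaningful.\<close>

lemma greatest_schreier_segment:
  assumes "infinite L" "L \<subseteq> {1..}" "1 \<le> k"
  defines "G \<equiv> (GREATEST I. initial_segment I L \<and> I \<in> schreier k)"
  shows "initial_segment G L" "G \<in> schreier k" "Inf L \<in> G"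
proof -
  define \<C> where "\<C> = {I. initial_segment I L \<and> I \<in> schreier k}"
  obtain q where q: "\<forall>F\<in>schreier k. \<not> L \<inter> {..q} \<subseteq> F" using schreier_compact assms by blast
  have "\<C> \<subseteq> Pow {..<q}" 
  proof
    fix I assume "I \<in> \<C>"
    then show "I \<in> Pow {..<q}"
      using initial_segment_bounded[of I L q] q by (simp add: \<C>_def)
  qed
  then have fin: "finite \<C>" by (rule finite_subset) simp
  have l: "Inf L \<in> L" using assms Inf_nat_def1[of L] by (metis finite.emptyI)
  have "initial_segment {Inf L} L"
    using l by (auto simp: initial_segment_def intro!: antisym cInf_lower)
  moreover have "{Inf L} \<in> schreier k"
    using schreier_singleton[of "Inf L" "k - 1"] l assms by auto
  ultimately have l\<C>: "{Inf L} \<in> \<C>" by (simp add: \<C>_def)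
  obtain M where M: "M \<in> \<C>" "\<And>I. I \<in> \<C> \<Longrightarrow> M \<subseteq> I \<Longrightarrow> I = M"
    using finite_has_maximal[OF fin] l\<C> by (metis empty_iff)
  have top: "I \<subseteq> M" if "I \<in> \<C>" for I
    using initial_segment_linear[of I L M] M that by (auto simp: \<C>_def)
  have "G = M"
    unfolding G_def using M(1) top by (intro Greatest_equality) (auto simp: \<C>_def)
  then show "initial_segment G L" "G \<in> schreier k" "Inf L \<in> G"
    using M top[OF l\<C>] by (auto simp: \<C>_def)
qed

text \<open>Candidates end before \<open>q\<close>, where the two sets agree. Equality of the
  predicates themselves lets the two \<open>GREATEST\<close> terms be identified by
  rewriting.\<close>

lemma schreier_segments_local:
  assumes "\<forall>F\<in>schreier k. \<not> L \<inter> {..q} \<subseteq> F" "L \<inter> {..q} = L' \<inter> {..q}"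
  shows "(\<lambda>I. initial_segment I L \<and> I \<in> schreier k) = (\<lambda>I. initial_segment I L' \<and> I \<in> schreier k)"
proof -
  have *: "initial_segment I B" if "initial_segment I A" "I \<in> schreier k"
      "\<forall>F\<in>schreier k. \<not> A \<inter> {..q} \<subseteq> F" "A \<inter> {..q} = B \<inter> {..q}" for I A B
  proof -
    have "I \<subseteq> {..<q}" using initial_segment_bounded that by blast
    then have le: "x \<le> q" if "x \<in> I" for x using that by auto
    have AB: "y \<in> A \<longleftrightarrow> y \<in> B" if "y \<le> q" for y
      using \<open>A \<inter> {..q} = B \<inter> {..q}\<close> that by blast
    show ?thesis unfolding initial_segment_def
    proof (intro conjI subsetI ballI impI)
      fix x assume x: "x \<in> I"
      then have "x \<in> A" using that(1) by (auto simp: initial_segment_def)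
      then show "x \<in> B" using AB le x by simp
      fix y assume "y \<in> B" "y \<le> x"
      then have "y \<in> A" using AB[of y] le[OF x] by simp
      then show "y \<in> I" using that(1) x \<open>y \<le> x\<close> unfolding initial_segment_def by blast
    qed
  qed
  have "\<forall>F\<in>schreier k. \<not> L' \<inter> {..q} \<subseteq> F" using assms by simp
  then show ?thesis
    using *[OF _ _ assms(1) assms(2)] *[OF _ _ _ assms(2)[symmetric]] by (intro ext iffI conjI) blast+
qed

lemma pairing_eq:
  assumes "finite A" "{i. x i \<noteq> 0} \<subseteq> A"
  shows "pairing f x = (\<Sum>i\<in>A. f i * x i)"
  unfolding pairing_def using assms by (intro sum.mono_neutral_left) auto

lemma L2_set_sum_le:
  "finite K \<Longrightarrow> L2_set (\<lambda>s. \<Sum>k\<in>K. f k s) S \<le> (\<Sum>k\<in>K. L2_set (f k) S)"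
proof (induction K rule: finite_induct)
  case (insert k K)
  then show ?case
    using L2_set_triangle_ineq[of "f k" "\<lambda>s. \<Sum>k\<in>K. f k s" S] by simp
qed (simp add: L2_set_0')

lemma finite_supp_indicator: "finite F \<Longrightarrow> finite {i. indicator F i \<noteq> (0::real)}"
  by (simp add: indicator_def)

section \<open>The functionals along branches\<close>

context jt_tree
begin

section \<open>Chains, branches and segments of the tree\<close>

lemma le_refl_D: "x \<in> insert 0 D \<Longrightarrow> x \<preceq> x"
  using le_refl unfolding reflp_on_def by blast

lemma le_trans_D: "x \<preceq> y \<Longrightarrow> y \<preceq> z \<Longrightarrow> {x, y, z} \<subseteq> insert 0 D \<Longrightarrow> x \<preceq> z"
  using le_trans unfolding transp_on_def by blast

lemma branch_infinite:
  assumes "branch \<sigma>"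
  shows "infinite \<sigma>"
proof
  assume fin: "finite \<sigma>"
  \<comment> \<open>The top of a finite branch, or the root if the branch is empty (branches omit
    the root). Adjoining one of its infinitely many successors contradicts maximality.\<close>
  define x where "x = (if \<sigma> = {} then 0 else Max \<sigma>)"
  have sub: "\<sigma> \<subseteq> D" and tot: "totalp_on \<sigma> (\<preceq>)"
    and max: "\<And>\<tau>. \<sigma> \<subseteq> \<tau> \<Longrightarrow> \<tau> \<subseteq> D \<Longrightarrow> totalp_on \<tau> (\<preceq>) \<Longrightarrow> \<tau> = \<sigma>"
    using assms by (auto simp: branch_def)
  have x\<sigma>: "x \<in> \<sigma>" if "\<sigma> \<noteq> {}" using fin that by (simp add: x_def)
  have x: "x \<in> insert 0 D" using x\<sigma> sub by (cases "\<sigma> = {}") (auto simp: x_def)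
  have "infinite {q \<in> insert 0 D. x \<preceq> q \<and> x \<noteq> q \<and>
      (\<forall>r\<in>insert 0 D. x \<preceq> r \<and> r \<preceq> q \<longrightarrow> r = x \<or> r = q)}"
    by (rule infinite_succs[OF x])
  then have "\<not> {q \<in> insert 0 D. x \<preceq> q \<and> x \<noteq> q \<and>
      (\<forall>r\<in>insert 0 D. x \<preceq> r \<and> r \<preceq> q \<longrightarrow> r = x \<or> r = q)} \<subseteq> insert 0 \<sigma>"
    using fin by (meson finite_insert finite_subset)
  then obtain q where q: "q \<in> D" "x \<preceq> q" "q \<notin> \<sigma>" by auto
  have below: "y \<preceq> q" if "y \<in> \<sigma>" for y
  proof -
    have xin: "x \<in> \<sigma>" using x\<sigma> that by auto
    have "y \<le> x" using that fin by (auto simp: x_def)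
    have "y \<preceq> x"
    proof (cases "y = x")
      case False
      then have "y \<preceq> x \<or> x \<preceq> y" using tot xin that by (auto simp: totalp_on_def)
      then show ?thesis using le_compat[of x y] xin that sub False \<open>y \<le> x\<close> by auto
    qed (use le_refl_D x in simp)
    then show ?thesis using le_trans_D[of y x q] q that sub x by auto
  qed
  have "totalp_on (insert q \<sigma>) (\<preceq>)" using tot below by (auto simp: totalp_on_def)
  then have "insert q \<sigma> = \<sigma>" using max[of "insert q \<sigma>"] sub q by auto
  then show False using q by auto
qed

text \<open>Supplies the positivity hypothesis of the Schreier lemmas, to which branches are fed as
  sets of coordinates.\<close>

lemma branch_subset: "branch \<sigma> \<Longrightarrow> \<sigma> \<subseteq> {1..}"
  using D_pos by (auto simp: branch_def)

text \<open>Adjoining all predecessors of \<open>i\<close> keeps a branch linearly ordered, so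
  maximality puts them in already. The right-hand side does not mention the branch: all branches
  through \<open>i\<close> agree up to \<open>i\<close>.\<close>

lemma branch_pred:
  assumes "branch \<sigma>" "i \<in> \<sigma>"
  shows "\<sigma> \<inter> {..i} = {x \<in> D. x \<preceq> i}"
proof -
  have sub: "\<sigma> \<subseteq> D" and tot: "totalp_on \<sigma> (\<preceq>)"
    and max: "\<And>\<tau>. \<sigma> \<subseteq> \<tau> \<Longrightarrow> \<tau> \<subseteq> D \<Longrightarrow> totalp_on \<tau> (\<preceq>) \<Longrightarrow> \<tau> = \<sigma>"
    using assms by (auto simp: branch_def)
  have i: "i \<in> D" using sub assms by auto
  have 1: "x \<preceq> i" if "x \<in> \<sigma>" "x \<le> i" for x
  proof (cases "x = i")
    case False
    then have "x \<preceq> i \<or> i \<preceq> x" using tot assms that by (auto simp: totalp_on_def)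
    then show ?thesis using le_compat[of i x] sub that assms False by auto
  qed (use le_refl_D sub that in auto)
  let ?\<tau> = "\<sigma> \<union> {x \<in> D. x \<preceq> i}"
  have mix: "y \<preceq> z \<or> z \<preceq> y" if "y \<in> \<sigma>" "z \<in> D" "z \<preceq> i" "y \<noteq> z" for y z
  proof (cases "y \<le> i")
    case True
    then show ?thesis using predecessors_chain[of i] 1[of y] i that sub
      by (auto simp: totalp_on_def)
  next
    case False
    then have "y \<noteq> i" "\<not> y \<preceq> i" using le_compat[of y i] sub that i by auto
    then have "i \<preceq> y" using tot assms that unfolding totalp_on_def by blast
    then show ?thesis using le_trans_D[of z i y] that sub i by auto
  qed
  have "totalp_on ?\<tau> (\<preceq>)"
    unfolding totalp_on_def
  proof (intro ballI impI)
    fix x y assume xy: "x \<in> ?\<tau>" "y \<in> ?\<tau>" "x \<noteq> y"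
    have pre: "totalp_on {y \<in> insert 0 D. y \<preceq> i} (\<preceq>)" using predecessors_chain[of i] i by simp
    consider "x \<in> \<sigma>" "y \<in> \<sigma>" | "x \<in> \<sigma>" "y \<in> D" "y \<preceq> i" | "y \<in> \<sigma>" "x \<in> D" "x \<preceq> i"
      | "x \<in> D" "x \<preceq> i" "y \<in> D" "y \<preceq> i" using xy by blast
    then show "x \<preceq> y \<or> y \<preceq> x"
    proof cases
      case 1 then show ?thesis using tot xy(3) by (simp add: totalp_on_def)
    next
      case 2 then show ?thesis using mix[of x y] xy(3) by simp
    next
      case 3 then show ?thesis using mix[of y x] xy(3) by auto
    next
      case 4 then show ?thesis using pre xy(3) by (simp add: totalp_on_def)
    qed
  qed
  then have "?\<tau> = \<sigma>" using max[of ?\<tau>] sub by auto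
  then show ?thesis using 1 sub le_compat i by auto
qed

text \<open>Zorn's lemma for the linearly ordered subsets of \<open>D\<close> that contain
  \<open>C\<close>.\<close>

lemma ex_branch:
  assumes "C \<subseteq> D" "totalp_on C (\<preceq>)"
  shows "\<exists>\<sigma>. branch \<sigma> \<and> C \<subseteq> \<sigma>"
proof -
  define A where "A = {\<tau>. C \<subseteq> \<tau> \<and> \<tau> \<subseteq> D \<and> totalp_on \<tau> (\<preceq>)}"
  have "\<Union>\<C> \<in> A" if "\<C> \<noteq> {}" "subset.chain A \<C>" for \<C>
  proof -
    have \<C>: "\<C> \<subseteq> A" "\<And>X Y. X \<in> \<C> \<Longrightarrow> Y \<in> \<C> \<Longrightarrow> X \<subseteq> Y \<or> Y \<subseteq> X"
      using that(2) by (auto simp: subset_chain_def)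
    have "totalp_on (\<Union>\<C>) (\<preceq>)"
      unfolding totalp_on_def
    proof (intro ballI impI)
      fix x y assume "x \<in> \<Union>\<C>" "y \<in> \<Union>\<C>" "x \<noteq> y"
      then obtain X where "X \<in> \<C>" "x \<in> X" "y \<in> X" using \<C>(2) by blast
      then show "x \<preceq> y \<or> y \<preceq> x"
        using \<C>(1) \<open>x \<noteq> y\<close> by (auto simp: A_def totalp_on_def)
    qed
    then show ?thesis using \<C>(1) that(1) by (auto simp: A_def)
  qed
  moreover have "A \<noteq> {}" using assms by (auto simp: A_def)
  ultimately obtain M where M: "M \<in> A" "\<forall>X\<in>A. M \<subseteq> X \<longrightarrow> X = M"
    using subset_Zorn_nonempty[of A] by metis
  then have "branch M" unfolding branch_def A_def by blast
  then show ?thesis using M by (auto simp: A_def)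
qed

lemma segment_subset: "segment s \<Longrightarrow> s \<subseteq> D"
  by (auto simp: segment_def)

lemma segment_total:
  assumes "segment s"
  shows "totalp_on s (\<preceq>)"
proof -
  obtain a b where ab: "a \<in> D" "b \<in> D" "s = {k \<in> D. a \<preceq> k \<and> k \<preceq> b}"
    using assms by (auto simp: segment_def)
  then show ?thesis
    using predecessors_chain[of b] by (auto simp: totalp_on_def)
qed

lemma segment_Min:
  assumes "segment s"
  shows "finite s" "Min s \<in> s"
proof -
  obtain a b where ab: "a \<in> D" "b \<in> D" "a \<preceq> b" "s = {k \<in> D. a \<preceq> k \<and> k \<preceq> b}"
    using assms by (auto simp: segment_def)
  have "s \<subseteq> {..b}" using ab le_compat by auto
  then show "finite s" by (rule finite_subset) simp
  moreover have "a \<in> s" using ab le_refl_D by auto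
  ultimately show "Min s \<in> s" by (metis Min_in empty_iff)
qed

definition branch_of :: "nat set \<Rightarrow> nat set" where
  "branch_of s = (SOME \<sigma>. branch \<sigma> \<and> s \<subseteq> \<sigma>)"

lemma branch_of:
  assumes "segment s"
  shows "branch (branch_of s)" "s \<subseteq> branch_of s"
proof -
  have "branch (branch_of s) \<and> s \<subseteq> branch_of s"
    unfolding branch_of_def
    by (rule someI_ex[OF ex_branch[OF segment_subset[OF assms] segment_total[OF assms]]])
  then show "branch (branch_of s)" "s \<subseteq> branch_of s" by blast+
qed

section \<open>Blocks of a branch and the size of the functionals carried by them\<close>

lemma m_ge: "1 \<le> j \<Longrightarrow> j \<le> m j"
proof (induction j)
  case (Suc j)
  show ?case
  proof (cases "j = 0")
    case True
    then show ?thesis using m_pos_le_n[of 1] by auto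
  next
    case False
    then have "m j < m (Suc j)" using m_strict by (auto simp: strict_mono_on_def)
    then show ?thesis using Suc False by simp
  qed
qed simp

lemma next_index_pos: "1 \<le> next_index s"
  by (simp add: next_index_def)

lemma n_next_index_pos: "1 \<le> n (next_index s)"
  using m_pos_le_n[OF next_index_pos[of s]] by simp

definition remainder :: "nat set \<Rightarrow> nat \<Rightarrow> nat set" where
  "remainder \<sigma> k = \<sigma> - (\<Union>i\<in>{1..k}. blk \<sigma> i)"

lemma blk_Suc_eq:
  "blk \<sigma> (Suc k) = (GREATEST I. initial_segment I (remainder \<sigma> k) \<and>
     I \<in> schreier (n (next_index (blk \<sigma> k))))"
  by (simp add: remainder_def)

lemma remainder_Suc: "remainder \<sigma> (Suc k) = remainder \<sigma> k - blk \<sigma> (Suc k)"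
  unfolding remainder_def using atLeastAtMostSuc_conv[of 1 k] by force

lemma remainder_0: "remainder \<sigma> 0 = \<sigma>"
  by (simp add: remainder_def)

declare blk.simps(2) [simp del]

lemma remainder_subset: "remainder \<sigma> k \<subseteq> \<sigma>"
  by (auto simp: remainder_def)

lemma remainder_infinite:
  assumes "infinite \<sigma>" "\<sigma> \<subseteq> {1..}"
  shows "infinite (remainder \<sigma> k)"
proof (induction k)
  case (Suc k)
  have "remainder \<sigma> k \<subseteq> {1..}" using assms remainder_subset by blast
  then have "blk \<sigma> (Suc k) \<in> schreier (n (next_index (blk \<sigma> k)))"
    unfolding blk_Suc_eq using greatest_schreier_segment(2) Suc n_next_index_pos by blast
  then have "finite (blk \<sigma> (Suc k))" by (rule schreier_finite)
  then show ?case using Suc by (simp add: remainder_Suc)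
qed (simp add: assms remainder_0)

lemma blk_Suc:
  assumes "infinite \<sigma>" "\<sigma> \<subseteq> {1..}"
  shows "blk \<sigma> (Suc k) \<subseteq> remainder \<sigma> k" "finite (blk \<sigma> (Suc k))"
    "Inf (remainder \<sigma> k) \<in> blk \<sigma> (Suc k)"
proof -
  have "remainder \<sigma> k \<subseteq> {1..}" using assms remainder_subset by blast
  note g = greatest_schreier_segment[OF remainder_infinite[OF assms] this
      n_next_index_pos[of "blk \<sigma> k"], folded blk_Suc_eq]
  show "blk \<sigma> (Suc k) \<subseteq> remainder \<sigma> k" using g(1) by (simp add: initial_segment_def)
  show "finite (blk \<sigma> (Suc k))" using g(2) by (rule schreier_finite)
  show "Inf (remainder \<sigma> k) \<in> blk \<sigma> (Suc k)" by (rule g(3))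
qed

text \<open>Every block takes at least the least element of the set that remains, so the minimum of
  the remainder grows strictly from a positive start.\<close>

lemma remainder_gt:
  assumes "infinite \<sigma>" "\<sigma> \<subseteq> {1..}" "x \<in> remainder \<sigma> k"
  shows "k < x"
  using assms(3)
proof (induction k arbitrary: x)
  case 0
  then show ?case using assms by (auto simp: remainder_0)
next
  case (Suc k)
  let ?i = "Inf (remainder \<sigma> k)"
  have i: "?i \<in> remainder \<sigma> k" using blk_Suc[OF assms(1,2)] by blast
  have "?i \<le> x" using Suc.prems by (auto simp: remainder_Suc intro: cInf_lower)
  moreover have "?i \<noteq> x" using Suc.prems blk_Suc(3)[OF assms(1,2), of k] by (auto simp: remainder_Suc)
  ultimately show ?case using Suc.IH[OF i] by simp
qed

lemma blk_disjoint:
  assumes "infinite \<sigma>" "\<sigma> \<subseteq> {1..}" "i < j" "1 \<le> i" "x \<in> blk \<sigma> i"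
  shows "x \<notin> blk \<sigma> j"
proof -
  obtain j' where j': "j = Suc j'" using assms(3) by (cases j) auto
  show ?thesis
    using blk_Suc(1)[OF assms(1,2), of j'] assms j' by (auto simp: remainder_def)
qed

text \<open>Each new block is a largest Schreier initial segment of the remainder, which by
  compactness is decided below some \<open>q\<close>. The bound \<open>p\<close> depends on
  \<open>\<tau>\<close> and \<open>K\<close> only, and the competing \<open>\<sigma>\<close> is an
  arbitrary set.\<close>

lemma blk_local:
  assumes "infinite \<tau>" "\<tau> \<subseteq> {1..}"
  shows "\<exists>p. \<forall>\<sigma>. \<sigma> \<inter> {..p} = \<tau> \<inter> {..p} \<longrightarrow> (\<forall>k\<le>K. blk \<sigma> k = blk \<tau> k)"
proof (induction K)
  case 0
  then show ?case by simp
next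
  case (Suc K)
  then obtain p where p: "\<forall>\<sigma>. \<sigma> \<inter> {..p} = \<tau> \<inter> {..p} \<longrightarrow> (\<forall>k\<le>K. blk \<sigma> k = blk \<tau> k)"
    by (rule exE)
  have "remainder \<tau> K \<subseteq> {1..}" using assms remainder_subset by blast
  then obtain q where q: "\<forall>F\<in>schreier (n (next_index (blk \<tau> K))). \<not> remainder \<tau> K \<inter> {..q} \<subseteq> F"
    using schreier_compact remainder_infinite[OF assms] by blast
  show ?case
  proof (intro exI[of _ "max p q"] allI impI)
    fix \<sigma> k assume eq: "\<sigma> \<inter> {..max p q} = \<tau> \<inter> {..max p q}" and k: "k \<le> Suc K"
    have eq': "y \<in> \<sigma> \<longleftrightarrow> y \<in> \<tau>" if "y \<le> max p q" for y using eq that by blast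
    have "\<sigma> \<inter> {..p} = \<tau> \<inter> {..p}" using eq' by auto
    then have b: "blk \<sigma> k = blk \<tau> k" if "k \<le> K" for k
      using p[rule_format, of \<sigma> k] that by blast
    have "remainder \<tau> K \<inter> {..q} = remainder \<sigma> K \<inter> {..q}"
      using eq' b by (auto simp: remainder_def)
    from schreier_segments_local[OF q this] have "blk \<sigma> (Suc K) = blk \<tau> (Suc K)"
      using b[of K] by (simp add: blk_Suc_eq)
    then show "blk \<sigma> k = blk \<tau> k" using b k by (cases "k = Suc K") auto
  qed
qed

lemma \<phi>_nonneg: "0 \<le> \<phi> \<sigma> k l"
  using rep_avg_bounds[THEN conjunct1] unfolding \<phi>_def Let_def by simp

lemma \<phi>_outside: "l \<notin> blk \<sigma> k \<Longrightarrow> \<phi> \<sigma> k l = 0"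
  by (simp add: \<phi>_def Let_def)

text \<open>The average is at most 1 and the denominator is the square of \<open>m r\<close>, where
  \<open>m r\<close> is at least \<open>r\<close>; the crude bound \<open>1 / r\<close> suffices for
  decay.\<close>

lemma \<phi>_le: "\<phi> \<sigma> k l \<le> 1 / real (next_index (blk \<sigma> (k - 1)))"
proof (cases "l \<in> blk \<sigma> k")
  case True
  define r where "r = next_index (blk \<sigma> (k - 1))"
  have r: "1 \<le> r" "r \<le> m r" using next_index_pos m_ge by (auto simp: r_def)
  have "\<phi> \<sigma> k l \<le> 1 / (real (m r))\<^sup>2"
    using True rep_avg_bounds
    unfolding \<phi>_def Let_def r_def by (auto intro!: divide_right_mono)
  also have "\<dots> \<le> 1 / real r"
  proof (intro divide_left_mono)
    have "real r \<le> real (m r)" "1 \<le> real (m r)" using r by auto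
    then show "real r \<le> (real (m r))\<^sup>2" by (smt (verit) mult_left_mono power2_eq_square mult_cancel_left1)
  qed (use r in auto)
  finally show ?thesis by (simp add: r_def)
qed (simp add: \<phi>_outside)

lemma \<phi>_le_1: "\<phi> \<sigma> k l \<le> 1"
proof -
  have "1 / real (next_index (blk \<sigma> (k - 1))) \<le> 1"
    using next_index_pos[of "blk \<sigma> (k - 1)"] by (simp add: divide_le_eq)
  with \<phi>_le[of \<sigma> k l] show ?thesis by linarith
qed

text \<open>The \<open>k\<close>-th block reaches at least to \<open>k\<close>, and
  \<open>\<gamma>\<close>, being strictly increasing, does not fall below the identity. With
  \<open>\<phi>_le\<close> this makes the functionals of late blocks small, for all branches at the
  same rate.\<close>

lemma next_index_blk_ge:
  assumes "infinite \<sigma>" "\<sigma> \<subseteq> {1..}"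
  shows "k \<le> next_index (blk \<sigma> k)"
proof (cases k)
  case (Suc j)
  let ?i = "Inf (remainder \<sigma> j)"
  note b = blk_Suc[OF assms, of j]
  have "j < ?i" using remainder_gt[OF assms] b by blast
  also have "?i \<le> Max (blk \<sigma> k)" using b Suc by auto
  also have "\<dots> \<le> \<gamma> (Max (blk \<sigma> k))" using \<gamma>_strict by (rule strict_mono_imp_increasing)
  finally show ?thesis using b Suc by (auto simp: next_index_def)
qed simp

text \<open>The denominators \<open>m\<^sub>r\<^sup>2\<close> in \<open>\<phi>\<close> grow along a chain, because early blocks are determined by an
  initial part of the chain.\<close>

lemma \<phi>_small_along_chain:
  assumes "infinite \<tau>" "\<tau> \<subseteq> {1..}"
  shows "\<exists>p. \<forall>i>p. \<forall>\<sigma> k. branch \<sigma> \<and> i \<in> \<sigma> \<and> \<sigma> \<inter> {..i} = \<tau> \<inter> {..i} \<longrightarrow>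
     \<phi> \<sigma> k i \<le> 1 / (1 + real K)"
proof -
  obtain p where p: "\<forall>\<sigma>. \<sigma> \<inter> {..p} = \<tau> \<inter> {..p} \<longrightarrow> (\<forall>k\<le>Suc K. blk \<sigma> k = blk \<tau> k)"
    using blk_local[OF assms, of "Suc K"] by (rule exE)
  have "finite (blk \<tau> k)" for k using blk_Suc(2)[OF assms] by (cases k) auto
  then have fin: "finite (\<Union>k\<le>Suc K. blk \<tau> k)" by blast
  \<comment> \<open>Beyond \<open>p'\<close> a point lies past all early blocks of
    \<open>\<tau>\<close>, which are those of \<open>\<sigma>\<close> as well. So early functionals
    vanish at \<open>i\<close>, and the others have index at least \<open>K + 1\<close>.\<close>
  define p' where "p' = max p (Max (insert 0 (\<Union>k\<le>Suc K. blk \<tau> k)))"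
  show ?thesis
  proof (intro exI[of _ p'] allI impI)
    fix i \<sigma> k assume "p' < i" and \<sigma>: "branch \<sigma> \<and> i \<in> \<sigma> \<and> \<sigma> \<inter> {..i} = \<tau> \<inter> {..i}"
    then have i: "p < i" "Max (insert 0 (\<Union>k\<le>Suc K. blk \<tau> k)) < i" by (auto simp: p'_def)
    have "y \<in> \<sigma> \<longleftrightarrow> y \<in> \<tau>" if "y \<le> i" for y using \<sigma> that by blast
    then have agree: "\<sigma> \<inter> {..p} = \<tau> \<inter> {..p}" using i(1) by fastforce
    have eq: "blk \<sigma> k = blk \<tau> k" if "k \<le> Suc K" for k
      using p[rule_format, OF agree that] .
    show "\<phi> \<sigma> k i \<le> 1 / (1 + real K)"
    proof (cases "k \<le> Suc K")
      case True
      have "i \<notin> blk \<tau> k"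
      proof
        assume "i \<in> blk \<tau> k"
        then have "i \<in> insert 0 (\<Union>k\<le>Suc K. blk \<tau> k)" using True by blast
        moreover have "finite (insert 0 (\<Union>k\<le>Suc K. blk \<tau> k))" using fin by blast
        ultimately show False using i(2) Max_ge leD by blast
      qed
      then have "\<phi> \<sigma> k i = 0" using eq[OF True] \<phi>_outside[of i \<sigma> k] by metis
      then show ?thesis by simp
    next
      case False
      have "Suc K \<le> k - 1" using False by simp
      also have "\<dots> \<le> next_index (blk \<sigma> (k - 1))"
        using next_index_blk_ge \<sigma> branch_infinite branch_subset by blast
      finally have "1 / real (next_index (blk \<sigma> (k - 1))) \<le> 1 / (1 + real K)"
        by (intro divide_left_mono) auto
      then show ?thesis using \<phi>_le[of \<sigma> k i] by linarith
    qed
  qed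
qed

section \<open>Segment norms and the norm of \<open>JT\<^sub>G\<close>\<close>

text \<open>The blocks are disjoint, so at most one summand is nonzero at \<open>l\<close>, and its
  coefficient has modulus at most 1.\<close>

lemma W_bound:
  assumes "branch \<sigma>" "f \<in> W \<sigma>" "0 \<le> B" "\<And>k. \<phi> \<sigma> k l \<le> B"
  shows "\<bar>f l\<bar> \<le> B"
proof -
  obtain N c E where f: "f = restr (\<lambda>l. \<Sum>i = 1..N. c i * \<phi> \<sigma> i l) E"
    and c: "(\<Sum>i = 1..N. (c i)\<^sup>2) \<le> 1"
    using assms(2) by (auto simp: W_def)
  have "\<bar>\<Sum>i = 1..N. c i * \<phi> \<sigma> i l\<bar> \<le> B"
  proof (cases "\<exists>j\<in>{1..N}. l \<in> blk \<sigma> j")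
    case True
    then obtain j where j: "j \<in> {1..N}" "l \<in> blk \<sigma> j" by blast
    have "\<phi> \<sigma> i l = 0" if "i \<in> {1..N} - {j}" for i
    proof (rule \<phi>_outside)
      note d = blk_disjoint[OF branch_infinite[OF assms(1)] branch_subset[OF assms(1)]]
      show "l \<notin> blk \<sigma> i"
        using d[of i j l] d[of j i l] j that by (cases "i < j") auto
    qed
    then have "(\<Sum>i = 1..N. c i * \<phi> \<sigma> i l) = c j * \<phi> \<sigma> j l"
      using j by (subst sum.mono_neutral_right[of _ "{j}"]) auto
    moreover have "(c j)\<^sup>2 \<le> 1\<^sup>2"
      using member_le_sum[of j "{1..N}" "\<lambda>i. (c i)\<^sup>2"] j c by simp
    then have "\<bar>c j\<bar> \<le> 1" using abs_le_square_iff[of "c j" 1] by simp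
    then have "\<bar>c j * \<phi> \<sigma> j l\<bar> \<le> 1 * B"
      unfolding abs_mult using \<phi>_nonneg[of \<sigma> j l] assms(4)[of j] by (intro mult_mono) auto
    ultimately show ?thesis by simp
  next
    case False
    then have "(\<Sum>i = 1..N. c i * \<phi> \<sigma> i l) = 0" by (intro sum.neutral) (simp add: \<phi>_outside)
    then show ?thesis using assms(3) by simp
  qed
  then show ?thesis using assms(3) by (simp add: f restr_def)
qed

lemma W_restr:
  assumes "f \<in> W \<sigma>" "nat_interval E"
  shows "restr f E \<in> W \<sigma>"
proof -
  obtain N c E' where f: "f = restr (\<lambda>l. \<Sum>i = 1..N. c i * \<phi> \<sigma> i l) E'" and "1 \<le> N"
    "\<forall>i\<in>{1..N}. c i \<in> \<rat>" "(\<Sum>i = 1..N. (c i)\<^sup>2) \<le> 1" "nat_interval E'"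
    using assms(1) by (auto simp: W_def)
  moreover have "restr f E = restr (\<lambda>l. \<Sum>i = 1..N. c i * \<phi> \<sigma> i l) (E' \<inter> E)"
    unfolding f restr_def by auto
  moreover have "nat_interval (E' \<inter> E)"
    using assms(2) \<open>nat_interval E'\<close> unfolding nat_interval_def by blast
  ultimately show ?thesis unfolding W_def by blast
qed

lemma W_uminus:
  assumes "f \<in> W \<sigma>"
  shows "(\<lambda>l. - f l) \<in> W \<sigma>"
proof -
  obtain N c E where f: "f = restr (\<lambda>l. \<Sum>i = 1..N. c i * \<phi> \<sigma> i l) E" and "1 \<le> N"
    "\<forall>i\<in>{1..N}. c i \<in> \<rat>" "(\<Sum>i = 1..N. (c i)\<^sup>2) \<le> 1" "nat_interval E"
    using assms by (auto simp: W_def)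
  moreover have "(\<lambda>l. - f l) = restr (\<lambda>l. \<Sum>i = 1..N. (- c i) * \<phi> \<sigma> i l) E"
    unfolding f restr_def by (auto simp: sum_negf)
  moreover have "\<forall>i\<in>{1..N}. - c i \<in> \<rat>" "(\<Sum>i = 1..N. (- c i)\<^sup>2) \<le> 1"
    using calculation by auto
  ultimately show ?thesis unfolding W_def
    by (intro CollectI exI[of _ N] exI[of _ "\<lambda>i. - c i"] exI[of _ E]) simp
qed

lemma W_nonempty: "W \<sigma> \<noteq> {}"
proof -
  have "restr (\<lambda>l. \<Sum>i = 1..1. 0 * \<phi> \<sigma> i l) {} \<in> W \<sigma>"
    unfolding W_def
    by (rule CollectI, rule exI[of _ 1], rule exI[of _ "\<lambda>_. 0"], rule exI[of _ "{}"])
      (simp add: nat_interval_def)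
  then show ?thesis by blast
qed

section \<open>Estimates for segment norms\<close>

lemma segment_norm_eq: "segment_norm s x = (SUP f\<in>W (branch_of s). pairing f (restr x s))"
  by (simp add: segment_norm_def branch_norm_def branch_of_def)

text \<open>Bounds the supremum defining \<open>segment_norm\<close>; without boundedness the
  real-valued \<open>SUP\<close> would carry no information.\<close>

lemma pairing_le_sum:
  assumes "segment s" "f \<in> W (branch_of s)" "finite A" "{i. x i \<noteq> 0} \<subseteq> A"
  shows "pairing f (restr x s) \<le> (\<Sum>i\<in>A \<inter> s. \<bar>x i\<bar>)"
proof -
  have "pairing f (restr x s) = (\<Sum>i\<in>A \<inter> s. f i * restr x s i)"
    using assms by (intro pairing_eq) (auto simp: restr_def)
  also have "\<dots> \<le> (\<Sum>i\<in>A \<inter> s. \<bar>x i\<bar>)"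
  proof (intro sum_mono)
    fix i assume "i \<in> A \<inter> s"
    have "\<bar>f i\<bar> \<le> 1" using W_bound[OF branch_of(1) assms(2)] assms(1) \<phi>_le_1 by simp
    then have "\<bar>f i * x i\<bar> \<le> 1 * \<bar>x i\<bar>" unfolding abs_mult by (intro mult_right_mono) auto
    then show "f i * restr x s i \<le> \<bar>x i\<bar>" by (auto simp: restr_def)
  qed
  finally show ?thesis .
qed

lemma pairing_le_segment_norm:
  assumes "segment s" "f \<in> W (branch_of s)" "finite {i. x i \<noteq> 0}"
  shows "pairing f (restr x s) \<le> segment_norm s x"
  unfolding segment_norm_eq
proof (rule cSUP_upper[OF assms(2)])
  show "bdd_above ((\<lambda>f. pairing f (restr x s)) ` W (branch_of s))"
    using pairing_le_sum[OF assms(1) _ assms(3) subset_refl] by (intro bdd_aboveI2) auto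
qed

lemma segment_norm_least:
  assumes "\<And>f. f \<in> W (branch_of s) \<Longrightarrow> pairing f (restr x s) \<le> B"
  shows "segment_norm s x \<le> B"
  unfolding segment_norm_eq using assms W_nonempty by (intro cSUP_least)

lemma abs_pairing_le_segment_norm:
  assumes "segment s" "f \<in> W (branch_of s)" "finite {i. x i \<noteq> 0}"
  shows "\<bar>pairing f (restr x s)\<bar> \<le> segment_norm s x"
proof -
  have "pairing (\<lambda>l. - f l) (restr x s) = - pairing f (restr x s)"
    by (simp add: pairing_def sum_negf)
  then show ?thesis
    using pairing_le_segment_norm[OF assms] pairing_le_segment_norm[OF assms(1) W_uminus[OF assms(2)] assms(3)]
    by linarith
qed

lemma segment_norm_nonneg:
  assumes "segment s" "finite {i. x i \<noteq> 0}"
  shows "0 \<le> segment_norm s x"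
  using abs_pairing_le_segment_norm[OF assms(1) _ assms(2)] W_nonempty
  by (metis abs_ge_zero ex_in_conv order_trans)

lemma segment_norm_le_sum:
  assumes "segment s" "finite A" "{i. x i \<noteq> 0} \<subseteq> A"
  shows "segment_norm s x \<le> (\<Sum>i\<in>A \<inter> s. \<bar>x i\<bar>)"
  using pairing_le_sum assms by (intro segment_norm_least)

text \<open>Subadditivity. The vector has to agree with the combination on \<open>s\<close> only, as
  the norm sees nothing else; the antichain case relies on this freedom.\<close>

lemma segment_norm_sum_le:
  assumes "segment s" "finite K" "\<And>k. k \<in> K \<Longrightarrow> finite {i. u k i \<noteq> 0}"
    and x: "\<And>i. i \<in> s \<Longrightarrow> x i = (\<Sum>k\<in>K. a k * u k i)"
  shows "segment_norm s x \<le> (\<Sum>k\<in>K. \<bar>a k\<bar> * segment_norm s (u k))"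
proof (rule segment_norm_least)
  fix f assume f: "f \<in> W (branch_of s)"
  define A where "A = (\<Union>k\<in>K. {i. u k i \<noteq> 0})"
  have A: "finite A" using assms by (auto simp: A_def)
  have zero: "u k i = 0" if "k \<in> K" "i \<notin> A" for k i using that by (auto simp: A_def)
  have "{i. restr x s i \<noteq> 0} \<subseteq> A"
  proof
    fix i assume i: "i \<in> {i. restr x s i \<noteq> 0}"
    show "i \<in> A"
    proof (rule ccontr)
      assume "i \<notin> A"
      then have "(\<Sum>k\<in>K. a k * u k i) = 0" using zero by (intro sum.neutral) auto
      then show False using i x by (auto simp: restr_def split: if_splits)
    qed
  qed
  then have "pairing f (restr x s) = (\<Sum>i\<in>A. f i * restr x s i)" using A by (intro pairing_eq)
  also have "\<dots> = (\<Sum>i\<in>A. \<Sum>k\<in>K. a k * (f i * restr (u k) s i))"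
    by (intro sum.cong) (auto simp: restr_def x sum_distrib_left mult_ac)
  also have "\<dots> = (\<Sum>k\<in>K. a k * (\<Sum>i\<in>A. f i * restr (u k) s i))"
    by (subst sum.swap) (simp add: sum_distrib_left)
  also have "\<dots> = (\<Sum>k\<in>K. a k * pairing f (restr (u k) s))"
  proof (intro sum.cong refl)
    fix k assume "k \<in> K"
    then have "{i. restr (u k) s i \<noteq> 0} \<subseteq> A" by (auto simp: A_def restr_def)
    then show "a k * (\<Sum>i\<in>A. f i * restr (u k) s i) = a k * pairing f (restr (u k) s)"
      using pairing_eq[OF A] by metis
  qed
  also have "\<dots> \<le> (\<Sum>k\<in>K. \<bar>a k\<bar> * segment_norm s (u k))"
  proof (intro sum_mono)
    fix k assume "k \<in> K"
    then have "\<bar>a k * pairing f (restr (u k) s)\<bar> \<le> \<bar>a k\<bar> * segment_norm s (u k)"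
      unfolding abs_mult using abs_pairing_le_segment_norm[OF assms(1) f] assms(3)
      by (intro mult_left_mono) auto
    then show "a k * pairing f (restr (u k) s) \<le> \<bar>a k\<bar> * segment_norm s (u k)" by linarith
  qed
  finally show "pairing f (restr x s) \<le> (\<Sum>k\<in>K. \<bar>a k\<bar> * segment_norm s (u k))" .
qed

lemma segment_norm_scale_le:
  assumes "segment s" "finite {i. y i \<noteq> 0}" "\<And>i. i \<in> s \<Longrightarrow> x i = c * y i"
  shows "segment_norm s x \<le> \<bar>c\<bar> * segment_norm s y"
  \<comment> \<open>Scaling is the sum estimate for a single term, indexed by the unit type.\<close>
  using segment_norm_sum_le[OF assms(1), of "{()}" "\<lambda>_. y" x "\<lambda>_. c"] assms by simp

text \<open>Restriction moves from the vector to the functional, where \<open>W_restr\<close>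
  applies.\<close>

lemma segment_norm_restr_le:
  assumes "segment s" "finite {i. x i \<noteq> 0}" "nat_interval E"
  shows "segment_norm s (restr x E) \<le> segment_norm s x"
proof (rule segment_norm_least)
  fix f assume f: "f \<in> W (branch_of s)"
  have "pairing f (restr (restr x E) s) = (\<Sum>i | x i \<noteq> 0. f i * restr (restr x E) s i)"
    using assms(2) by (intro pairing_eq) (auto simp: restr_def)
  also have "\<dots> = (\<Sum>i | x i \<noteq> 0. restr f E i * restr x s i)"
    by (intro sum.cong) (auto simp: restr_def)
  also have "\<dots> = pairing (restr f E) (restr x s)"
    using assms(2) by (intro pairing_eq[symmetric]) (auto simp: restr_def)
  also have "\<dots> \<le> segment_norm s x"
    by (rule pairing_le_segment_norm[OF assms(1) W_restr[OF f assms(3)] assms(2)])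
  finally show "pairing f (restr (restr x E) s) \<le> segment_norm s x" .
qed

lemma segment_norm_zero:
  assumes "segment s" "finite {i. x i \<noteq> 0}" "\<And>i. i \<in> s \<Longrightarrow> x i = 0"
  shows "segment_norm s x = 0"
  using segment_norm_nonneg[OF assms(1,2)] segment_norm_scale_le[OF assms(1,2), of x 0] assms(3)
  by simp

lemma segment_norm_single_le:
  assumes "segment s" "\<And>j. j \<in> s \<Longrightarrow> j \<noteq> i \<Longrightarrow> x j = 0"
    and "0 \<le> B" "i \<in> s \<Longrightarrow> (\<And>k. \<phi> (branch_of s) k i \<le> B)"
  shows "segment_norm s x \<le> B * \<bar>x i\<bar>"
proof (rule segment_norm_least)
  fix f assume f: "f \<in> W (branch_of s)"
  have "pairing f (restr x s) = (\<Sum>j\<in>{i}. f j * restr x s j)"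
    using assms(2) by (intro pairing_eq) (auto simp: restr_def)
  also have "\<dots> \<le> B * \<bar>x i\<bar>"
  proof (cases "i \<in> s")
    case True
    then have "\<bar>f i\<bar> \<le> B" using W_bound[OF branch_of(1) f assms(3)] assms(1,4) by simp
    then have "\<bar>f i * x i\<bar> \<le> B * \<bar>x i\<bar>" unfolding abs_mult by (intro mult_right_mono) auto
    then show ?thesis using True by (simp add: restr_def)
  next
    case False
    then show ?thesis using assms(3) by (simp add: restr_def)
  qed
  finally show "pairing f (restr x s) \<le> B * \<bar>x i\<bar>" .
qed

section \<open>Admissible families and the norm of the space\<close>

lemma admissible_inj_Min:
  assumes "admissible S"
  shows "inj_on Min S"
proof (rule inj_onI)
  fix s t assume st: "s \<in> S" "t \<in> S" "Min s = Min t"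
  then have "segment s" "segment t" using assms by (auto simp: admissible_def)
  then have "Min s \<in> s" "Min s \<in> t" using st segment_Min by metis+
  then have "\<not> disjnt s t" by (auto simp: disjnt_def)
  then show "s = t" using assms st by (auto simp: admissible_def pairwise_def)
qed

text \<open>Disjoint segments have different minima, so no coordinate collects two terms. The set of
  minima is itself in the first Schreier family, so the supremum is attained there.\<close>

lemma S2_norm_admissible:
  assumes "admissible S"
  shows "S2_norm (\<lambda>i. \<Sum>s\<in>S. p s * (if i = Min s then 1 else 0)) = L2_set p S"
proof -
  define y where "y = (\<lambda>i. \<Sum>s\<in>S. p s * (if i = Min s then 1 else 0))"
  have fin: "finite S" and sch: "Min ` S \<in> schreier 1" using assms by (auto simp: admissible_def)
  note inj = admissible_inj_Min[OF assms]
  have y_Min: "y (Min s) = p s" if "s \<in> S" for s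
  proof -
    have "y (Min s) = (\<Sum>t\<in>{s}. p t * (if Min s = Min t then 1 else 0))"
      unfolding y_def using fin that inj
      by (intro sum.mono_neutral_right) (auto simp: inj_on_def)
    then show ?thesis by simp
  qed
  have y_0: "y i = 0" if "i \<notin> Min ` S" for i
    unfolding y_def using that by (intro sum.neutral) auto
  have eq: "sqrt (\<Sum>i\<in>Min ` S. (y i)\<^sup>2) = L2_set p S"
    unfolding L2_set_def by (simp add: sum.reindex[OF inj] y_Min cong: sum.cong)
  have le: "sqrt (\<Sum>i\<in>F. (y i)\<^sup>2) \<le> L2_set p S" if "F \<in> schreier 1" for F
  proof -
    have "finite F" using that schreier_finite by blast
    then have "(\<Sum>i\<in>F. (y i)\<^sup>2) = (\<Sum>i\<in>F \<inter> Min ` S. (y i)\<^sup>2)"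
      using y_0 by (intro sum.mono_neutral_right) auto
    also have "\<dots> \<le> (\<Sum>i\<in>Min ` S. (y i)\<^sup>2)" using fin by (intro sum_mono2) auto
    finally show ?thesis unfolding eq[symmetric] by simp
  qed
  have "S2_norm y = L2_set p S"
    unfolding S2_norm_def
  proof (rule antisym)
    show "(SUP F\<in>schreier 1. sqrt (\<Sum>i\<in>F. (y i)\<^sup>2)) \<le> L2_set p S"
      using le sch by (intro cSUP_least) auto
    have "bdd_above ((\<lambda>F. sqrt (\<Sum>i\<in>F. (y i)\<^sup>2)) ` schreier 1)"
      using le by (intro bdd_aboveI2)
    from cSUP_upper[OF sch this] show "L2_set p S \<le> (SUP F\<in>schreier 1. sqrt (\<Sum>i\<in>F. (y i)\<^sup>2))"
      unfolding eq .
  qed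
  then show ?thesis by (simp add: y_def)
qed

lemma jt_norm_eq:
  "jt_norm x = max (SUP i. \<bar>x i\<bar>)
     (SUP S\<in>{S. admissible S}. L2_set (\<lambda>s. segment_norm s x) S)"
  unfolding jt_norm_def by (simp add: S2_norm_admissible cong: SUP_cong_simp)

lemma admissible_empty: "admissible {}"
  by (simp add: admissible_def)

lemma admissible_segment: "admissible S \<Longrightarrow> s \<in> S \<Longrightarrow> segment s"
  by (simp add: admissible_def)

lemma admissible_finite: "admissible S \<Longrightarrow> finite S"
  by (simp add: admissible_def)

lemma jt_norm_least:
  assumes "\<And>i. \<bar>x i\<bar> \<le> B" "\<And>S. admissible S \<Longrightarrow> L2_set (\<lambda>s. segment_norm s x) S \<le> B"
  shows "jt_norm x \<le> B"
  unfolding jt_norm_eq using assms admissible_empty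
  by (auto intro!: cSUP_least max.boundedI)

lemma
  assumes "finite {i. x i \<noteq> 0}"
  shows abs_le_jt_norm: "\<bar>x i\<bar> \<le> jt_norm x"
    and L2_set_le_jt_norm: "admissible S \<Longrightarrow> L2_set (\<lambda>s. segment_norm s x) S \<le> jt_norm x"
proof -
  have "\<bar>x i\<bar> \<le> (\<Sum>i | x i \<noteq> 0. \<bar>x i\<bar>)" for i
    using assms by (cases "x i = 0") (auto intro: member_le_sum sum_nonneg)
  then have "bdd_above (range (\<lambda>i. \<bar>x i\<bar>))" by (intro bdd_aboveI2)
  then have "\<bar>x i\<bar> \<le> (SUP i. \<bar>x i\<bar>)" by (intro cSUP_upper) auto
  then show "\<bar>x i\<bar> \<le> jt_norm x" unfolding jt_norm_eq by simp
  let ?A = "{i. x i \<noteq> 0}"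
  \<comment> \<open>The l_1 norm dominates every admissible family, because disjoint segments use
    disjoint coordinates. This makes the outer supremum a genuine one.\<close>
  have "L2_set (\<lambda>s. segment_norm s x) S \<le> (\<Sum>i\<in>?A. \<bar>x i\<bar>)" if S: "admissible S" for S
  proof -
    have "L2_set (\<lambda>s. segment_norm s x) S \<le> (\<Sum>s\<in>S. segment_norm s x)"
      using segment_norm_nonneg admissible_segment[OF S] assms by (intro L2_set_le_sum) auto
    also have "\<dots> \<le> (\<Sum>s\<in>S. \<Sum>i\<in>?A \<inter> s. \<bar>x i\<bar>)"
      using segment_norm_le_sum[OF _ assms] admissible_segment[OF S] by (intro sum_mono) auto
    also have "\<dots> = (\<Sum>i\<in>(\<Union>s\<in>S. ?A \<inter> s). \<bar>x i\<bar>)"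
      using S assms
      by (intro sum.UNION_disjoint[symmetric]) (auto simp: admissible_def pairwise_def disjnt_def)
    also have "\<dots> \<le> (\<Sum>i\<in>?A. \<bar>x i\<bar>)" using assms by (intro sum_mono2) auto
    finally show ?thesis .
  qed
  then have "bdd_above ((\<lambda>S. L2_set (\<lambda>s. segment_norm s x) S) ` {S. admissible S})"
    by (intro bdd_aboveI2) auto
  then have "L2_set (\<lambda>s. segment_norm s x) S \<le> (SUP S\<in>{S. admissible S}. L2_set (\<lambda>s. segment_norm s x) S)"
    if "admissible S" for S using that by (intro cSUP_upper) auto
  then show "L2_set (\<lambda>s. segment_norm s x) S \<le> jt_norm x" if "admissible S"
    using that unfolding jt_norm_eq by (meson max.coboundedI2)
qed

text \<open>Source of all lower estimates: projecting a sum of blocks onto one interval isolates one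
  block without increasing the norm.\<close>

lemma jt_norm_restr_le:
  assumes "finite {i. x i \<noteq> 0}" "nat_interval E"
  shows "jt_norm (restr x E) \<le> jt_norm x"
proof (rule jt_norm_least)
  show "\<bar>restr x E i\<bar> \<le> jt_norm x" for i
    using abs_le_jt_norm[OF assms(1), of i] by (auto simp: restr_def)
  fix S assume S: "admissible S"
  have "finite {i. restr x E i \<noteq> 0}"
    by (rule finite_subset[OF _ assms(1)]) (auto simp: restr_def)
  then have "L2_set (\<lambda>s. segment_norm s (restr x E)) S \<le> L2_set (\<lambda>s. segment_norm s x) S"
    using segment_norm_restr_le[OF _ assms] segment_norm_nonneg admissible_segment[OF S]
    by (intro L2_set_mono) auto
  also have "\<dots> \<le> jt_norm x" by (rule L2_set_le_jt_norm[OF assms(1) S])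
  finally show "L2_set (\<lambda>s. segment_norm s (restr x E)) S \<le> jt_norm x" .
qed

lemma jt_norm_unit: "jt_norm (indicator {i}) = 1"
proof (rule antisym)
  have fin: "finite {j. indicator {i} j \<noteq> (0::real)}" by (simp add: indicator_def)
  show "1 \<le> jt_norm (indicator {i})" using abs_le_jt_norm[OF fin, of i] by simp
  show "jt_norm (indicator {i}) \<le> 1"
  proof (rule jt_norm_least)
    show "\<bar>indicator {i} j\<bar> \<le> (1::real)" for j by (simp add: indicator_def)
    fix S assume S: "admissible S"
    have le: "segment_norm s (indicator {i}) \<le> (if i \<in> s then 1 else 0)" if "s \<in> S" for s
      using segment_norm_le_sum[OF admissible_segment[OF S that], of "{i}" "indicator {i}"]
      by (cases "i \<in> s") (simp_all add: indicator_def)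
    have "L2_set (\<lambda>s. segment_norm s (indicator {i})) S \<le> (\<Sum>s\<in>S. segment_norm s (indicator {i}))"
      using segment_norm_nonneg[OF admissible_segment[OF S] fin] by (intro L2_set_le_sum)
    also have "\<dots> \<le> (\<Sum>s\<in>S. if i \<in> s then 1 else 0)" using le by (intro sum_mono)
    also have "\<dots> = real (card {s \<in> S. i \<in> s})"
      using admissible_finite[OF S] by (simp add: sum.If_cases Int_def)
    also have "card {s \<in> S. i \<in> s} \<le> 1"
    proof (subst One_nat_def, rule card_le_Suc0_iff_eq[THEN iffD2])
      show "finite {s \<in> S. i \<in> s}" using admissible_finite[OF S] by simp
      show "\<forall>s\<in>{s \<in> S. i \<in> s}. \<forall>t\<in>{s \<in> S. i \<in> s}. s = t"
        using S unfolding admissible_def pairwise_def disjnt_def by blast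
    qed
    finally show "L2_set (\<lambda>s. segment_norm s (indicator {i})) S \<le> 1" by simp
  qed
qed

section \<open>Block sequences equivalent to the unit vector basis of \<open>c\<^sub>0\<close>\<close>

text \<open>One inequality suffices, since applying it with a factor and with its inverse gives
  homogeneity.\<close>

lemma jt_norm_scale_le:
  assumes "finite {i. x i \<noteq> 0}"
  shows "jt_norm (\<lambda>i. c * x i) \<le> \<bar>c\<bar> * jt_norm x"
proof (rule jt_norm_least)
  show "\<bar>c * x i\<bar> \<le> \<bar>c\<bar> * jt_norm x" for i
    unfolding abs_mult using abs_le_jt_norm[OF assms] by (intro mult_left_mono) auto
  fix S assume S: "admissible S"
  have fin: "finite {i. c * x i \<noteq> 0}" by (rule finite_subset[OF _ assms]) auto
  have "L2_set (\<lambda>s. segment_norm s (\<lambda>i. c * x i)) S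
      \<le> L2_set (\<lambda>s. \<bar>c\<bar> * segment_norm s x) S"
    using admissible_segment[OF S] segment_norm_nonneg[OF _ fin] segment_norm_scale_le[OF _ assms]
    by (intro L2_set_mono) auto
  also have "\<dots> = \<bar>c\<bar> * L2_set (\<lambda>s. segment_norm s x) S"
    by (rule L2_set_right_distrib[symmetric]) simp
  also have "\<dots> \<le> \<bar>c\<bar> * jt_norm x"
    using L2_set_le_jt_norm[OF assms S] by (intro mult_left_mono) auto
  finally show "L2_set (\<lambda>s. segment_norm s (\<lambda>i. c * x i)) S \<le> \<bar>c\<bar> * jt_norm x" .
qed

text \<open>The smallness is calibrated to admissibility: a family whose first minimum is at most
  \<open>q k\<close> has at most \<open>q k\<close> segments, so together they contribute at most
  \<open>(1 / 2) ^ q k\<close> on the \<open>k\<close>-th block.\<close>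

lemma block_sum_le:
  assumes "strict_mono q" and supp: "\<And>k. {i. u k i \<noteq> 0} \<subseteq> {q k<..q (Suc k)}"
    and one: "\<And>k. jt_norm (u k) \<le> 1"
    and small: "\<And>k s. segment s \<Longrightarrow> segment_norm s (u k) \<le> 1 / (real (Suc (q k)) * 2 ^ q k)"
    and a: "\<And>k. k < K \<Longrightarrow> \<bar>a k\<bar> \<le> M" and "0 \<le> M"
  shows "jt_norm (\<lambda>i. \<Sum>k<K. a k * u k i) \<le> 3 * M"
proof (rule jt_norm_least)
  have fin: "finite {i. u k i \<noteq> 0}" for k by (rule finite_subset[OF supp]) simp
  have q_mono: "i \<le> j \<Longrightarrow> q i \<le> q j" for i j
    using assms(1) by (simp add: strict_mono_less_eq)
  fix i
  show "\<bar>\<Sum>k<K. a k * u k i\<bar> \<le> 3 * M"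
  proof (cases "\<exists>j<K. u j i \<noteq> 0")
    case True
    then obtain j where j: "j < K" "u j i \<noteq> 0" by blast
    have ij: "q j < i" "i \<le> q (Suc j)" using supp[of j] j by auto
    have "u k i = 0" if "k \<noteq> j" for k
    proof (rule ccontr)
      assume "u k i \<noteq> 0"
      then have "q k < i" "i \<le> q (Suc k)" using supp[of k] by auto
      then show False using ij q_mono[of "Suc k" j] q_mono[of "Suc j" k] that by linarith
    qed
    then have "(\<Sum>k<K. a k * u k i) = a j * u j i"
      using j by (subst sum.mono_neutral_right[of _ "{j}"]) auto
    also have "\<bar>\<dots>\<bar> \<le> M * 1"
      unfolding abs_mult using a[OF j(1)] abs_le_jt_norm[OF fin, of j i] one[of j] \<open>0 \<le> M\<close>
      by (intro mult_mono) auto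
    finally show ?thesis using \<open>0 \<le> M\<close> by simp
  next
    case False
    then show ?thesis using \<open>0 \<le> M\<close> by simp
  qed
next
  have fin: "finite {i. u k i \<noteq> 0}" for k by (rule finite_subset[OF supp]) simp
  have q_mono: "i \<le> j \<Longrightarrow> q i \<le> q j" for i j
    using assms(1) by (simp add: strict_mono_less_eq)
  have q_ge: "k \<le> q k" for k using assms(1) by (rule strict_mono_imp_increasing)
  fix S assume S: "admissible S"
  note seg = admissible_segment[OF S]
  show "L2_set (\<lambda>s. segment_norm s (\<lambda>i. \<Sum>k<K. a k * u k i)) S \<le> 3 * M"
  proof (cases "S = {}")
    case True
    then show ?thesis using \<open>0 \<le> M\<close> by simp
  next
    case False
    define r where "r = Min (Min ` S)"
    have sch: "Min ` S \<in> schreier (Suc 0)" using S by (simp only: admissible_def One_nat_def)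
    then have "card (Min ` S) \<le> r" using False by (auto simp: r_def)
    then have cardS: "card S \<le> r" using card_image[OF admissible_inj_Min[OF S]] by simp
    have ge_r: "r \<le> i" if "s \<in> S" "i \<in> s" for s i
    proof -
      have "r \<le> Min s" using that admissible_finite[OF S] by (simp add: r_def)
      also have "\<dots> \<le> i" using segment_Min(1)[OF seg[OF that(1)]] that by simp
      finally show ?thesis .
    qed
    \<comment> \<open>The block whose interval is the first to reach \<open>r\<close>. Earlier
      blocks end before every segment of the family, block \<open>j\<close> is bounded by its norm
      1, and later ones start at or after \<open>r\<close>.\<close>
    define j where "j = (LEAST j. r \<le> q (Suc j))"
    have "r \<le> q (Suc r)" using q_ge[of "Suc r"] by simp
    then have j: "r \<le> q (Suc j)" unfolding j_def by (rule LeastI)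
    have L2: "L2_set (\<lambda>s. segment_norm s (u k)) S \<le> (1 / 2) ^ k + (if k = j then 1 else 0)" for k
    proof (cases k j rule: linorder_cases)
      case less
      then have "\<not> r \<le> q (Suc k)" unfolding j_def by (rule not_less_Least)
      then have "u k i = 0" if "s \<in> S" "i \<in> s" for s i
        using ge_r[OF that] supp[of k] by force
      then have "segment_norm s (u k) = 0" if "s \<in> S" for s
        using segment_norm_zero[OF seg fin] that by blast
      then have "L2_set (\<lambda>s. segment_norm s (u k)) S = 0" by (intro L2_set_0') simp
      then show ?thesis by simp
    next
      case equal
      have "L2_set (\<lambda>s. segment_norm s (u k)) S \<le> 1"
        using L2_set_le_jt_norm[OF fin S] one by (rule order_trans)
      also have "1 \<le> (1 / 2) ^ k + (1 :: real)" by simp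
      finally show ?thesis using equal by simp
    next
      case greater
      then have rq: "r \<le> q k" using j q_mono[of "Suc j" k] by simp
      have "L2_set (\<lambda>s. segment_norm s (u k)) S \<le> (\<Sum>s\<in>S. segment_norm s (u k))"
        using segment_norm_nonneg[OF seg fin] by (intro L2_set_le_sum)
      also have "\<dots> \<le> real (card S) * (1 / (real (Suc (q k)) * 2 ^ q k))"
        using small[OF seg] by (intro sum_bounded_above)
      also have "\<dots> \<le> real (Suc (q k)) * (1 / (real (Suc (q k)) * 2 ^ q k))"
        using cardS rq by (intro mult_right_mono) auto
      also have "\<dots> = (1 / 2) ^ q k" by (simp add: power_divide)
      also have "\<dots> \<le> (1 / 2) ^ k" using q_ge by (intro power_decreasing) auto
      finally show ?thesis using greater by simp
    qed
    have finx: "finite {i. (\<Sum>k<K. a k * u k i) \<noteq> 0}"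
    proof (rule finite_subset)
      show "{i. (\<Sum>k<K. a k * u k i) \<noteq> 0} \<subseteq> (\<Union>k<K. {i. u k i \<noteq> 0})"
      proof
        fix i assume "i \<in> {i. (\<Sum>k<K. a k * u k i) \<noteq> 0}"
        then obtain k where "k < K" "a k * u k i \<noteq> 0" by (metis (mono_tags, lifting) lessThan_iff mem_Collect_eq sum.not_neutral_contains_not_neutral)
        then show "i \<in> (\<Union>k<K. {i. u k i \<noteq> 0})" by auto
      qed
    qed (use fin in auto)
    have "L2_set (\<lambda>s. segment_norm s (\<lambda>i. \<Sum>k<K. a k * u k i)) S
        \<le> L2_set (\<lambda>s. \<Sum>k<K. M * segment_norm s (u k)) S"
    proof (rule L2_set_mono)
      fix s assume s: "s \<in> S"
      have "segment_norm s (\<lambda>i. \<Sum>k<K. a k * u k i) \<le> (\<Sum>k<K. \<bar>a k\<bar> * segment_norm s (u k))"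
        using fin by (intro segment_norm_sum_le[OF seg[OF s]]) auto
      also have "\<dots> \<le> (\<Sum>k<K. M * segment_norm s (u k))"
        using a segment_norm_nonneg[OF seg[OF s] fin] by (intro sum_mono mult_right_mono) auto
      finally show "segment_norm s (\<lambda>i. \<Sum>k<K. a k * u k i) \<le> (\<Sum>k<K. M * segment_norm s (u k))" .
    qed (use segment_norm_nonneg[OF seg finx] in auto)
    also have "\<dots> = M * L2_set (\<lambda>s. \<Sum>k<K. segment_norm s (u k)) S"
      using \<open>0 \<le> M\<close> by (simp add: L2_set_right_distrib sum_distrib_left)
    also have "\<dots> \<le> M * 3"
    proof (rule mult_left_mono[OF _ \<open>0 \<le> M\<close>])
      have "L2_set (\<lambda>s. \<Sum>k<K. segment_norm s (u k)) S
          \<le> (\<Sum>k<K. L2_set (\<lambda>s. segment_norm s (u k)) S)"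
        by (intro L2_set_sum_le) simp
      also have "\<dots> \<le> (\<Sum>k<K. (1 / 2) ^ k + (if k = j then 1 else 0))"
        using L2 by (intro sum_mono)
      also have "\<dots> = (\<Sum>k<K. (1 / 2) ^ k) + (if j < K then 1 else 0)"
        by (simp add: sum.distrib)
      also have "(\<Sum>k<K. (1 / 2 :: real) ^ k) = 2 - 2 * (1 / 2) ^ K"
        by (induction K) auto
      also have "\<dots> \<le> 2" by simp
      finally show "L2_set (\<lambda>s. \<Sum>k<K. segment_norm s (u k)) S \<le> 3"
        by (auto split: if_splits)
    qed
    finally show ?thesis by simp
  qed
qed

section \<open>Blocks with c_0 estimates inside a prescribed set of coordinates\<close>

text \<open>Only the upper c_0 estimate is recorded; the lower one follows from norm 1 and supports
  in successive intervals. The constant is a parameter because in the bounded antichain case it is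
  the given bound.\<close>

definition c0_blocks :: "nat set \<Rightarrow> (nat \<Rightarrow> nat \<Rightarrow> real) \<Rightarrow> (nat \<Rightarrow> nat) \<Rightarrow> real \<Rightarrow> bool" where
  "c0_blocks N u q C \<longleftrightarrow> strict_mono q \<and>
     (\<forall>k. {i. u k i \<noteq> 0} \<subseteq> N \<inter> {q k<..q (Suc k)} \<and> jt_norm (u k) = 1) \<and>
     (\<forall>a K M. 0 \<le> M \<longrightarrow> (\<forall>k<K. \<bar>a k\<bar> \<le> M) \<longrightarrow> jt_norm (\<lambda>i. \<Sum>k<K. a k * u k i) \<le> C * M)"

lemma c0_blocks_if_small:
  assumes "\<And>p \<epsilon>. 0 < \<epsilon> \<Longrightarrow> \<exists>v. finite {i. v i \<noteq> 0} \<and> {i. v i \<noteq> 0} \<subseteq> N \<inter> {p<..} \<and>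
      jt_norm v = 1 \<and> (\<forall>s. segment s \<longrightarrow> segment_norm s v \<le> \<epsilon>)"
  shows "\<exists>u q. c0_blocks N u q 3"
proof -
  \<comment> \<open>Vectors are chosen for all starting points \<open>p\<close> at once, with the
    tolerance that \<open>block_sum_le\<close> wants for \<open>q k = p\<close>. Iterating "last
    point of the support" then selects the blocks.\<close>
  have "\<exists>v. \<forall>p. finite {i. v p i \<noteq> 0} \<and> {i. v p i \<noteq> 0} \<subseteq> N \<inter> {p<..} \<and>
      jt_norm (v p) = 1 \<and> (\<forall>s. segment s \<longrightarrow> segment_norm s (v p) \<le> 1 / (real (Suc p) * 2 ^ p))"
    by (intro choice allI assms) simp
  then obtain v where v: "\<And>p. finite {i. v p i \<noteq> 0}" "\<And>p. {i. v p i \<noteq> 0} \<subseteq> N \<inter> {p<..}"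
      "\<And>p. jt_norm (v p) = 1"
      "\<And>p s. segment s \<Longrightarrow> segment_norm s (v p) \<le> 1 / (real (Suc p) * 2 ^ p)"
    by blast
  have ne: "{i. v p i \<noteq> 0} \<noteq> {}" for p
  proof
    assume "{i. v p i \<noteq> 0} = {}"
    \<comment> \<open>The zero vector has norm at most 0 by scaling, against norm 1; so
      \<open>Max\<close> is applied to nonempty supports.\<close>
    then have "v p = (\<lambda>i. 0 * v p i)" by auto
    then show False using jt_norm_scale_le[OF v(1), of 0 p] v(3)[of p] by simp
  qed
  define q where "q k = ((\<lambda>p. Max {i. v p i \<noteq> 0}) ^^ k) 0" for k
  have q_Suc: "q (Suc k) = Max {i. v (q k) i \<noteq> 0}" for k by (simp add: q_def)
  have "q k < q (Suc k)" for k
    using Max_in[OF v(1) ne, of "q k"] v(2)[of "q k"] unfolding q_Suc by blast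
  then have q: "strict_mono q" by (rule strict_mono_Suc_iff[THEN iffD2, rule_format])
  have supp: "{i. v (q k) i \<noteq> 0} \<subseteq> N \<inter> {q k<..q (Suc k)}" for k
    using v(2)[of "q k"] Max_ge[OF v(1), of _ "q k"] unfolding q_Suc by auto
  have "jt_norm (\<lambda>i. \<Sum>k<K. a k * v (q k) i) \<le> 3 * M"
    if "0 \<le> M" "\<forall>k<K. \<bar>a k\<bar> \<le> M" for a K M
    by (rule block_sum_le[OF q]) (use supp v that in auto)
  then have "c0_blocks N (\<lambda>k. v (q k)) q 3"
    unfolding c0_blocks_def using q supp v(3) by blast
  then show ?thesis by blast
qed

text \<open>Either sums of unit vectors beyond some point are uniformly bounded and the unit vectors
  themselves serve, or large sums can be normalised: their coefficients become tiny and a segment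
  meets only one of them.\<close>

lemma c0_blocks_antichain:
  assumes "infinite N" "N \<subseteq> {1..}"
    and single: "\<And>s i j. segment s \<Longrightarrow> i \<in> s \<inter> N \<Longrightarrow> j \<in> s \<inter> N \<Longrightarrow> i = j"
  shows "\<exists>u q C. c0_blocks N u q C"
proof (cases "\<exists>p C. \<forall>F. finite F \<and> F \<subseteq> N \<inter> {p<..} \<longrightarrow> jt_norm (indicator F) \<le> C")
  case True
  then obtain p C where C: "\<forall>F. finite F \<and> F \<subseteq> N \<inter> {p<..} \<longrightarrow> jt_norm (indicator F) \<le> C"
    by (elim exE)
  define N' where "N' = N \<inter> {p<..}"
  have "N \<subseteq> N' \<union> {..p}" by (auto simp: N'_def)
  then have inf: "infinite N'" using assms(1) by (meson finite_UnI finite_atMost finite_subset)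
  define x where "x = enumerate N'"
  have x: "x k \<in> N'" "strict_mono x" for k
    using enumerate_in_set[OF inf] strict_mono_enumerate[OF inf] by (auto simp: x_def)
  define u :: "nat \<Rightarrow> nat \<Rightarrow> real" where "u k = indicator {x k}" for k
  \<comment> \<open>Shifted by one, so that \<open>x k\<close> is the right end of the half-open
    interval from \<open>q k\<close> to \<open>q (Suc k)\<close>; the start 0 works since
    coordinates are positive.\<close>
  define q where "q k = (case k of 0 \<Rightarrow> 0 | Suc k' \<Rightarrow> x k')" for k
  have "q k < q (Suc k)" for k
    using x(1)[of k] x(2) assms(2) by (cases k) (auto simp: q_def N'_def strict_mono_Suc_iff)
  then have q: "strict_mono q" by (rule strict_mono_Suc_iff[THEN iffD2, rule_format])
  have "{i. u k i \<noteq> 0} \<subseteq> N \<inter> {q k<..q (Suc k)}" for k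
    using \<open>q k < q (Suc k)\<close> x(1)[of k] by (auto simp: u_def indicator_def N'_def q_def)
  moreover have "jt_norm (u k) = 1" for k unfolding u_def by (rule jt_norm_unit)
  moreover have "jt_norm (\<lambda>i. \<Sum>k<K. a k * u k i) \<le> C * M"
    if M: "0 \<le> M" "\<forall>k<K. \<bar>a k\<bar> \<le> M" for a K M
  proof -
    define F where "F = x ` {..<K}"
    define y where "y = (\<lambda>i. \<Sum>k<K. a k * u k i)"
    have F: "finite F" "F \<subseteq> N'" using x(1) by (auto simp: F_def)
    have "jt_norm (indicator F) \<le> C" using F C[rule_format, of F] unfolding N'_def by blast
    have y_in: "\<bar>y i\<bar> \<le> M" if iF: "i \<in> F" for i
    proof -
      obtain k where k: "k < K" "i = x k" using iF by (auto simp: F_def)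
      have "y i = (\<Sum>k'\<in>{k}. a k' * u k' i)"
        unfolding y_def using k x(2)
        by (intro sum.mono_neutral_right) (auto simp: u_def indicator_def strict_mono_eq)
      then show ?thesis using k M by (simp add: u_def)
    qed
    have y_out: "y i = 0" if "i \<notin> F" for i
      unfolding y_def using that by (intro sum.neutral) (auto simp: u_def F_def indicator_def)
    have finy: "finite {i. y i \<noteq> 0}" by (rule finite_subset[OF _ F(1)]) (use y_out in auto)
    note finF = finite_supp_indicator[OF F(1)]
    have "jt_norm y \<le> M * jt_norm (indicator F)"
    proof (rule jt_norm_least)
      fix i
      have "\<bar>y i\<bar> \<le> M * indicator F i"
        using y_in y_out by (cases "i \<in> F") auto
      also have "\<dots> \<le> M * jt_norm (indicator F)"
        using M abs_le_jt_norm[OF finF, of i] by (intro mult_left_mono) auto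
      finally show "\<bar>y i\<bar> \<le> M * jt_norm (indicator F)" .
    next
      fix S assume S: "admissible S"
      have le: "segment_norm s y \<le> M * segment_norm s (indicator F)" if "s \<in> S" for s
      proof -
        note s = admissible_segment[OF S that]
        \<comment> \<open>The segment meets \<open>F\<close> in at most one point, and the value of
          \<open>y\<close> there is the factor.\<close>
        have "\<exists>c. \<bar>c\<bar> \<le> M \<and> (\<forall>i\<in>s. y i = c * indicator F i)"
        proof (cases "\<exists>i. i \<in> s \<inter> F")
          case True
          then obtain i where i: "i \<in> s \<inter> F" by blast
          have "y j = y i * indicator F j" if "j \<in> s" for j
          proof (cases "j \<in> F")
            case True
            then have "j = i" using single[OF s, of i j] i that F by (auto simp: N'_def)
            then show ?thesis using i by simp
          qed (simp add: y_out)
          then show ?thesis using y_in[of i] i by blast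
        next
          case False
          then have "\<forall>i\<in>s. y i = 0 * indicator F i" using y_out by auto
          then show ?thesis using M by (intro exI[of _ 0]) auto
        qed
        then obtain c where c: "\<bar>c\<bar> \<le> M" "\<forall>i\<in>s. y i = c * indicator F i" by blast
        then have "segment_norm s y \<le> \<bar>c\<bar> * segment_norm s (indicator F)"
          using segment_norm_scale_le[OF s finF] by blast
        also have "\<dots> \<le> M * segment_norm s (indicator F)"
          using c segment_norm_nonneg[OF s finF] by (intro mult_right_mono) auto
        finally show ?thesis .
      qed
      have "L2_set (\<lambda>s. segment_norm s y) S \<le> L2_set (\<lambda>s. M * segment_norm s (indicator F)) S"
        using le segment_norm_nonneg[OF admissible_segment[OF S] finy] by (intro L2_set_mono)
      also have "\<dots> = M * L2_set (\<lambda>s. segment_norm s (indicator F)) S"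
        using L2_set_right_distrib[OF M(1)] by metis
      also have "\<dots> \<le> M * jt_norm (indicator F)"
        using L2_set_le_jt_norm[OF finF S] M(1) by (rule mult_left_mono)
      finally show "L2_set (\<lambda>s. segment_norm s y) S \<le> M * jt_norm (indicator F)" .
    qed
    also have "\<dots> \<le> M * C" using \<open>jt_norm (indicator F) \<le> C\<close> M(1) by (rule mult_left_mono)
    finally show ?thesis by (simp add: y_def mult.commute)
  qed
  ultimately have "c0_blocks N u q C" unfolding c0_blocks_def using q by blast
  then show ?thesis by blast
next
  case False
  have "\<exists>u q. c0_blocks N u q 3"
  proof (rule c0_blocks_if_small)
    fix p and \<epsilon> :: real assume "0 < \<epsilon>"
    have "\<forall>p C. \<exists>F. finite F \<and> F \<subseteq> N \<inter> {p<..} \<and> C < jt_norm (indicator F)"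
      using False by (simp add: not_le)
    then obtain F where F: "finite F \<and> F \<subseteq> N \<inter> {p<..} \<and> max 1 (1 / \<epsilon>) < jt_norm (indicator F)"
      by (elim allE exE)
    define c where "c = jt_norm (indicator F)"
    have c: "1 < c" "1 / \<epsilon> < c" using F by (auto simp: c_def)
    have finF0: "finite F" "F \<subseteq> N \<inter> {p<..}" using F by blast+
    note finF = finite_supp_indicator[OF finF0(1)]
    define v where "v = (\<lambda>i. 1 / c * indicator F i)"
    have v_supp: "{i. v i \<noteq> 0} \<subseteq> F" by (auto simp: v_def indicator_def)
    then have finv: "finite {i. v i \<noteq> 0}" using finF0(1) by (rule finite_subset)
    have "jt_norm v \<le> \<bar>1 / c\<bar> * c"
      unfolding v_def using jt_norm_scale_le[OF finF, of "1 / c"] by (simp add: c_def)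
    \<comment> \<open>Scaling back gives the reverse inequality, hence norm exactly 1.\<close>
    moreover have "(\<lambda>i. c * v i) = indicator F" using c by (auto simp: v_def)
    then have "c \<le> c * jt_norm v"
      using jt_norm_scale_le[OF finv, of c] c by (simp add: c_def)
    ultimately have "jt_norm v = 1" using c by (simp add: field_simps)
    moreover have "segment_norm s v \<le> \<epsilon>" if s: "segment s" for s
    proof -
      have "segment_norm s v \<le> (\<Sum>i\<in>F \<inter> s. \<bar>v i\<bar>)"
        by (rule segment_norm_le_sum[OF s finF0(1) v_supp])
      also have "\<dots> \<le> real (card (F \<inter> s)) * (1 / c)"
        using c by (intro sum_bounded_above) (auto simp: v_def indicator_def)
      also have "\<dots> \<le> 1 * (1 / c)"
      proof (rule mult_right_mono)
        have "card (F \<inter> s) \<le> Suc 0"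
          using finF0 single[OF s] by (subst card_le_Suc0_iff_eq) auto
        then show "real (card (F \<inter> s)) \<le> 1" by simp
      qed (use c in simp)
      also have "\<dots> \<le> \<epsilon>" using c \<open>0 < \<epsilon>\<close> by (simp add: field_simps)
      finally show ?thesis .
    qed
    ultimately show "\<exists>v. finite {i. v i \<noteq> 0} \<and> {i. v i \<noteq> 0} \<subseteq> N \<inter> {p<..} \<and>
      jt_norm v = 1 \<and> (\<forall>s. segment s \<longrightarrow> segment_norm s v \<le> \<epsilon>)"
      using finv v_supp finF0(2) by blast
  qed
  then show ?thesis by blast
qed

text \<open>Single unit vectors suffice: far out on the chain every functional that acts on them has
  a small coefficient.\<close>

lemma c0_blocks_chain:
  assumes "infinite N" "N \<subseteq> D" "\<And>i j. i \<in> N \<Longrightarrow> j \<in> N \<Longrightarrow> i \<preceq> j \<or> j \<preceq> i"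
  shows "\<exists>u q. c0_blocks N u q 3"
proof (rule c0_blocks_if_small)
  fix p and \<epsilon> :: real assume "0 < \<epsilon>"
  \<comment> \<open>The downward closure of the chain. Up to any \<open>i\<close> in
    \<open>N\<close> it consists of the predecessors of \<open>i\<close>, hence agrees there with
    every branch through \<open>i\<close>.\<close>
  define \<tau> where "\<tau> = {x \<in> D. \<exists>i\<in>N. x \<preceq> i}"
  have "N \<subseteq> \<tau>" using assms(2) le_refl_D by (auto simp: \<tau>_def)
  then have inf: "infinite \<tau>" using assms(1) finite_subset by blast
  have pos: "\<tau> \<subseteq> {1..}" using D_pos by (auto simp: \<tau>_def)
  have below: "\<tau> \<inter> {..i} = {x \<in> D. x \<preceq> i}" if i: "i \<in> N" for i
  proof
    show "{x \<in> D. x \<preceq> i} \<subseteq> \<tau> \<inter> {..i}"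
      using i assms(2) le_compat by (auto simp: \<tau>_def)
    show "\<tau> \<inter> {..i} \<subseteq> {x \<in> D. x \<preceq> i}"
    proof
      fix x assume "x \<in> \<tau> \<inter> {..i}"
      then obtain j where j: "x \<in> D" "x \<le> i" "j \<in> N" "x \<preceq> j" by (auto simp: \<tau>_def)
      have iD: "i \<in> D" "j \<in> D" using i j assms(2) by auto
      have "x \<preceq> i"
      proof (cases "x = i")
        case True
        then show ?thesis using le_refl_D iD by simp
      next
        case False
        then have "\<not> i \<preceq> x" using le_compat[of i x] iD j by auto
        then show ?thesis
          using assms(3)[OF i j(3)] predecessors_chain[of j] le_trans_D[of x j i] j iD False
          unfolding totalp_on_def by blast
      qed
      then show "x \<in> {x \<in> D. x \<preceq> i}" using j by simp
    qed
  qed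
  obtain K where K: "1 / (1 + real K) < \<epsilon>"
    using reals_Archimedean[OF \<open>0 < \<epsilon>\<close>] by (auto simp: field_simps)
  obtain p' where p': "\<And>i \<sigma> k. p' < i \<Longrightarrow> branch \<sigma> \<Longrightarrow> i \<in> \<sigma> \<Longrightarrow> \<sigma> \<inter> {..i} = \<tau> \<inter> {..i} \<Longrightarrow>
      \<phi> \<sigma> k i \<le> 1 / (1 + real K)"
    using \<phi>_small_along_chain[OF inf pos, of K] by metis
  obtain i where i: "i \<in> N" "max p p' < i"
    using assms(1) unfolding infinite_nat_iff_unbounded by blast
  have "segment_norm s (indicator {i}) \<le> \<epsilon>" if s: "segment s" for s
  proof -
    have "segment_norm s (indicator {i}) \<le> 1 / (1 + real K) * \<bar>indicator {i} i\<bar>"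
    proof (rule segment_norm_single_le[OF s])
      fix k assume "i \<in> s"
      then have "i \<in> branch_of s" using branch_of(2)[OF s] by blast
      then show "\<phi> (branch_of s) k i \<le> 1 / (1 + real K)"
        using branch_pred[OF branch_of(1)[OF s]] below[OF i(1)] i(2)
        by (intro p' branch_of s) auto
    qed auto
    then show ?thesis using K by simp
  qed
  moreover have "{j. indicator {i} j \<noteq> (0::real)} = {i}" by (auto simp: indicator_def)
  ultimately show "\<exists>v. finite {i. v i \<noteq> 0} \<and> {i. v i \<noteq> 0} \<subseteq> N \<inter> {p<..} \<and>
      jt_norm v = 1 \<and> (\<forall>s. segment s \<longrightarrow> segment_norm s v \<le> \<epsilon>)"
    using i jt_norm_unit[of i] by (intro exI[of _ "indicator {i}"]) auto
qed

proposition ex_c0_blocks: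
  assumes "infinite N" "N \<subseteq> {1..}"
  shows "\<exists>u q C. c0_blocks N u q C"
proof -
  \<comment> \<open>Colour 0 also demands membership in \<open>D\<close>. Points outside the tree
    thus get colour 1, harmless because no segment contains them.\<close>
  define f :: "nat set \<Rightarrow> nat" where
    "f X = (if \<forall>x\<in>X. \<forall>y\<in>X. x \<in> D \<and> (x \<preceq> y \<or> y \<preceq> x) then 0 else 1)" for X
  have "\<exists>Y t. Y \<subseteq> N \<and> infinite Y \<and> t < 2 \<and> (\<forall>x\<in>Y. \<forall>y\<in>Y. x \<noteq> y \<longrightarrow> f {x, y} = t)"
    by (rule Ramsey2[OF assms(1)]) (simp add: f_def)
  then obtain Y t where Y: "Y \<subseteq> N" "infinite Y" and t: "t < 2"
    "\<And>x y. x \<in> Y \<Longrightarrow> y \<in> Y \<Longrightarrow> x \<noteq> y \<Longrightarrow> f {x, y} = t" by blast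
  have "\<exists>u q C. c0_blocks Y u q C"
  proof (cases "t = 0")
    case True
    have *: "x \<in> D \<and> (x \<preceq> y \<or> y \<preceq> x)" if "x \<in> Y" "y \<in> Y" "x \<noteq> y" for x y
      using t(2)[OF that] True by (auto simp: f_def split: if_splits)
    have "x \<in> D" if "x \<in> Y" for x
    proof -
      obtain y where "y \<in> Y - {x}" using Y(2) by (metis finite.emptyI infinite_remove ex_in_conv)
      then show ?thesis using * that by blast
    qed
    then show ?thesis using c0_blocks_chain[OF Y(2)] * le_refl_D by (metis insertI2 subsetI)
  next
    case False
    show ?thesis
    proof (rule c0_blocks_antichain[OF Y(2)])
      show "Y \<subseteq> {1..}" using Y(1) assms(2) by blast
      fix s i j assume s: "segment s" "i \<in> s \<inter> Y" "j \<in> s \<inter> Y"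
      show "i = j"
      proof (rule ccontr)
        assume "i \<noteq> j"
        have "i \<in> D" "j \<in> D" using s segment_subset by auto
        moreover have "i \<preceq> j \<or> j \<preceq> i"
          using segment_total[OF s(1)] s \<open>i \<noteq> j\<close> by (auto simp: totalp_on_def)
        ultimately have "f {i, j} = 0" using le_refl_D by (auto simp: f_def)
        then show False using t(2)[of i j] s \<open>i \<noteq> j\<close> False by simp
      qed
    qed
  qed
  then obtain u q C where "c0_blocks Y u q C" by (elim exE)
  then have "c0_blocks N u q C" using Y(1) unfolding c0_blocks_def by blast
  then show ?thesis by (intro exI)
qed

end

section \<open>Copies of \<open>c\<^sub>0\<close> in completions\<close>

lemma subspace_c0: "subspace c0"
  unfolding subspace_def c0_def by (auto intro: tendsto_add_zero tendsto_mult_right_zero)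

lemma closed_c0: "closed c0"
  unfolding closed_sequential_limits
proof (intro allI impI)
  fix f and l :: "nat \<Rightarrow>\<^sub>C real"
  assume "(\<forall>n. f n \<in> c0) \<and> f \<longlonglongrightarrow> l"
  then have f: "\<And>n. f n \<in> c0" "f \<longlonglongrightarrow> l" by auto
  have "apply_bcontfun l \<longlonglongrightarrow> 0"
  proof (rule LIMSEQ_I)
    fix r :: real assume "0 < r"
    then obtain n where n: "dist (f n) l < r / 2"
      using f(2) unfolding lim_sequentially by (metis half_gt_zero order_refl)
    have "apply_bcontfun (f n) \<longlonglongrightarrow> 0" using f(1) by (simp add: c0_def)
    then obtain K where K: "\<And>k. k \<ge> K \<Longrightarrow> norm (apply_bcontfun (f n) k - 0) < r / 2"
      using LIMSEQ_D[of _ 0 "r / 2"] \<open>0 < r\<close> by (metis half_gt_zero)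
    have "norm (apply_bcontfun l k - 0) < r" if "k \<ge> K" for k
      using K[OF that] n dist_bounded[of "f n" k l] by (simp add: dist_real_def)
    then show "\<exists>K. \<forall>k\<ge>K. norm (apply_bcontfun l k - 0) < r" by blast
  qed
  then show "l \<in> c0" by (simp add: c0_def)
qed

text \<open>The library instance \<^class>\<open>complete_space\<close> assumes a metric on the domain, which \<^typ>\<open>nat\<close> lacks.\<close>

lemma bcontfun_Cauchy_convergent:
  fixes f :: "nat \<Rightarrow> 'a::topological_space \<Rightarrow>\<^sub>C 'b::complete_space"
  assumes "Cauchy f"
  shows "convergent f"
proof -
  have "\<forall>r>0. \<exists>N. \<forall>m n x. N \<le> m \<and> N \<le> n \<and> True \<longrightarrow>
      dist (apply_bcontfun (f m) x) (apply_bcontfun (f n) x) < r"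
    using assms dist_fun_lt_imp_dist_val_lt unfolding Cauchy_def by meson
  then obtain g where "\<forall>r>0. \<exists>N. \<forall>n x. N \<le> n \<longrightarrow> dist (apply_bcontfun (f n) x) (g x) < r"
    using uniformly_convergent_eq_cauchy[of "\<lambda>_. True" "\<lambda>n. apply_bcontfun (f n)"] by auto
  then have "uniform_limit UNIV f g sequentially"
    unfolding uniform_limit_sequentially_iff by blast
  from uniform_limit_bcontfunE[OF this sequentially_bot] show ?thesis by (metis convergentI)
qed

text \<open>The series with coefficients from \<open>c0\<close> converge by \<open>upper\<close>,
  and the two estimates place the norm of the image between \<open>norm f\<close> and
  \<open>C * norm f\<close>. Completeness of \<open>c0\<close> then makes the image closed.\<close>

proposition c0_isomorphic_subspace:
  fixes U :: "nat \<Rightarrow> 'b::banach"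
  assumes upper: "\<And>a K M. 0 \<le> M \<Longrightarrow> (\<And>k. k < K \<Longrightarrow> \<bar>a k\<bar> \<le> M) \<Longrightarrow>
      norm (\<Sum>k<K. a k *\<^sub>R U k) \<le> C * M"
    and lower: "\<And>a K j. j < K \<Longrightarrow> \<bar>a j\<bar> \<le> norm (\<Sum>k<K. a k *\<^sub>R U k)"
    and V: "closed V" "\<And>a K. (\<Sum>k<K. a k *\<^sub>R U k) \<in> V"
  shows "\<exists>Y. subspace Y \<and> closed Y \<and> Y \<subseteq> V \<and> isomorphic_subspaces c0 Y"
proof -
  have C: "0 \<le> C" using upper[of 1 0 "\<lambda>_. 0"] by simp
  define T where "T f = (\<Sum>k. apply_bcontfun f k *\<^sub>R U k)" for f
  have summable: "summable (\<lambda>k. apply_bcontfun f k *\<^sub>R U k)" if f: "f \<in> c0" for f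
    unfolding summable_Cauchy
  proof (intro allI impI)
    fix r :: real assume "0 < r"
    \<comment> \<open>The added 1 covers \<open>C = 0\<close>.\<close>
    define d where "d = r / (C + 1)"
    have d: "0 < d" "C * d < r" using \<open>0 < r\<close> C by (auto simp: d_def field_simps)
    obtain K where K: "\<And>k. k \<ge> K \<Longrightarrow> \<bar>apply_bcontfun f k\<bar> < d"
      using LIMSEQ_D[of "apply_bcontfun f" 0 d] d f by (auto simp: c0_def)
    have "norm (\<Sum>k = m..<n. apply_bcontfun f k *\<^sub>R U k) < r" if "m \<ge> K" for m n
    proof -
      have "(\<Sum>k = m..<n. apply_bcontfun f k *\<^sub>R U k)
          = (\<Sum>k<n. (if m \<le> k then apply_bcontfun f k else 0) *\<^sub>R U k)"
        by (intro sum.mono_neutral_cong_left) auto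
      also have "norm \<dots> \<le> C * d"
        using K that d by (intro upper) (auto intro: less_imp_le)
      finally show ?thesis using d by simp
    qed
    then show "\<exists>K. \<forall>m\<ge>K. \<forall>n. norm (\<Sum>k = m..<n. apply_bcontfun f k *\<^sub>R U k) < r" by blast
  qed
  then have T_lim: "(\<lambda>K. \<Sum>k<K. apply_bcontfun f k *\<^sub>R U k) \<longlonglongrightarrow> T f" if "f \<in> c0" for f
    using that unfolding T_def by (intro summable_LIMSEQ)
  have T_add: "T (f + g) = T f + T g" if "f \<in> c0" "g \<in> c0" for f g
    unfolding T_def using summable[OF that(1)] summable[OF that(2)]
    by (simp add: scaleR_add_left suminf_add)
  have T_scale: "T (a *\<^sub>R f) = a *\<^sub>R T f" if "f \<in> c0" for a f
    unfolding T_def using suminf_scaleR_right[OF summable[OF that], of a] by simp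
  have T_diff: "T (f - g) = T f - T g" if "f \<in> c0" "g \<in> c0" for f g
    using T_add[of f "(-1) *\<^sub>R g"] T_scale[of g "-1"] that subspace_scale[OF subspace_c0, of g "-1"]
    by simp
  have diff: "f - g \<in> c0" if "f \<in> c0" "g \<in> c0" for f g
    using that subspace_diff[OF subspace_c0] by blast
  have T_le: "norm (T f) \<le> C * norm f" if "f \<in> c0" for f
  proof (rule LIMSEQ_le_const2[OF tendsto_norm[OF T_lim[OF that]]])
    show "\<exists>N. \<forall>n\<ge>N. norm (\<Sum>k<n. apply_bcontfun f k *\<^sub>R U k) \<le> C * norm f"
      using norm_bounded[of f] by (intro exI allI impI upper) auto
  qed
  have T_ge: "norm f \<le> norm (T f)" if "f \<in> c0" for f
  proof (rule norm_bound)
    fix j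
    show "norm (apply_bcontfun f j) \<le> norm (T f)"
    proof (rule LIMSEQ_le_const[OF tendsto_norm[OF T_lim[OF that]]])
      show "\<exists>N. \<forall>n\<ge>N. norm (apply_bcontfun f j) \<le> norm (\<Sum>k<n. apply_bcontfun f k *\<^sub>R U k)"
        using lower by (intro exI[of _ "Suc j"]) auto
    qed
  qed
  have inj: "inj_on T c0"
  proof (rule inj_onI)
    fix f g assume fg: "f \<in> c0" "g \<in> c0" "T f = T g"
    then have "norm (f - g) \<le> 0" using T_ge[OF diff[OF fg(1,2)]] T_diff by simp
    then show "f = g" by simp
  qed
  define Y where "Y = T ` c0"
  define S where "S = inv_into c0 T"
  have S: "S (T f) = f" if "f \<in> c0" for f using inj that by (simp add: S_def)
  have cont_T: "continuous_on c0 T"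
    unfolding continuous_on_iff
  proof (intro ballI allI impI)
    fix f and r :: real assume f: "f \<in> c0" "0 < r"
    have "dist (T g) (T f) < r" if "g \<in> c0" "dist g f < r / (C + 1)" for g
    proof -
      have "dist (T g) (T f) \<le> C * dist g f"
        using T_le[OF diff[OF that(1) f(1)]] T_diff[OF that(1) f(1)] by (simp add: dist_norm)
      also have "\<dots> \<le> (C + 1) * dist g f" by (intro mult_right_mono) auto
      also have "\<dots> < r" using that(2) C by (simp add: field_simps)
      finally show ?thesis .
    qed
    then show "\<exists>d>0. \<forall>g\<in>c0. dist g f < d \<longrightarrow> dist (T g) (T f) < r"
      using f(2) C by (intro exI[of _ "r / (C + 1)"]) auto
  qed
  have dist_S: "dist f g \<le> dist (T f) (T g)" if "f \<in> c0" "g \<in> c0" for f g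
    using T_ge[OF diff[OF that]] T_diff[OF that] by (simp add: dist_norm)
  have cont_S: "continuous_on Y S"
    unfolding continuous_on_iff
  proof (intro ballI allI impI)
    fix y and r :: real assume y: "y \<in> Y" "0 < r"
    have "dist (S y') (S y) < r" if "y' \<in> Y" "dist y' y < r" for y'
      using that y dist_S S unfolding Y_def by fastforce
    then show "\<exists>d>0. \<forall>y'\<in>Y. dist y' y < d \<longrightarrow> dist (S y') (S y) < r" using y(2) by blast
  qed
  have sub: "subspace Y"
    unfolding subspace_def
  proof (intro conjI ballI allI)
    have "T 0 = 0" using T_scale[of 0 0] subspace_0[OF subspace_c0] by simp
    then show "0 \<in> Y" unfolding Y_def using subspace_0[OF subspace_c0] by (metis imageI)
    fix x y a assume x: "x \<in> Y"
    then obtain f where f: "f \<in> c0" "x = T f" by (auto simp: Y_def)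
    then show "a *\<^sub>R x \<in> Y"
      unfolding Y_def using T_scale[OF f(1), of a] subspace_scale[OF subspace_c0 f(1), of a]
      by (metis imageI)
    assume "y \<in> Y"
    then obtain g where g: "g \<in> c0" "y = T g" by (auto simp: Y_def)
    then show "x + y \<in> Y"
      unfolding Y_def using T_add[OF f(1) g(1)] f subspace_add[OF subspace_c0 f(1) g(1)]
      by (metis imageI)
  qed
  moreover have "closed Y"
    unfolding closed_sequential_limits
  proof (intro allI impI)
    fix y l assume "(\<forall>n. y n \<in> Y) \<and> y \<longlonglongrightarrow> l"
    then have y: "\<And>n. y n \<in> Y" "y \<longlonglongrightarrow> l" by auto
    obtain f where f: "\<And>n. f n \<in> c0" "\<And>n. y n = T (f n)"
      using y(1) unfolding Y_def image_iff by metis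
    \<comment> \<open>The inverse is 1-Lipschitz, so convergence of the images pulls back to a
      Cauchy sequence in \<open>c0\<close>.\<close>
    have "Cauchy f"
      using LIMSEQ_imp_Cauchy[OF y(2)] dist_S f unfolding Cauchy_def
      by (metis le_less_trans)
    then have "convergent f" by (rule bcontfun_Cauchy_convergent)
    then obtain g where g: "f \<longlonglongrightarrow> g" unfolding convergent_def by (rule exE)
    then have gc: "g \<in> c0" using closed_c0 f(1) unfolding closed_sequential_limits by blast
    have "(\<lambda>n. T (f n)) \<longlonglongrightarrow> T g"
      using continuous_on_tendsto_compose[OF cont_T g gc] f(1) by simp
    then have "l = T g" using y(2) f(2) LIMSEQ_unique by (metis (no_types, lifting) ext)
    then show "l \<in> Y" using gc by (auto simp: Y_def)
  qed
  moreover have "Y \<subseteq> V"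
  proof
    fix y assume "y \<in> Y"
    then obtain f where f: "f \<in> c0" "y = T f" by (auto simp: Y_def)
    then show "y \<in> V" using closed_sequentially[OF V(1) V(2) T_lim[OF f(1)]] by simp
  qed
  moreover have "S ` Y = c0" unfolding Y_def image_image using S by simp
  then have "homeomorphism c0 Y T S"
    unfolding homeomorphism_def using cont_T cont_S S by (auto simp: Y_def)
  then have "isomorphic_subspaces c0 Y"
    unfolding isomorphic_subspaces_def using subspace_c0 sub T_add T_scale by blast
  ultimately show ?thesis by blast
qed

section \<open>The embedding of \<open>c00\<close> into a completion\<close>

definition c00_embed :: "(nat \<Rightarrow> 'b::real_normed_vector) \<Rightarrow> (nat \<Rightarrow> real) \<Rightarrow> 'b" where
  "c00_embed e x = (\<Sum>i | x i \<noteq> 0. x i *\<^sub>R e i)"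

lemma c00_embed_eq: "finite A \<Longrightarrow> {i. x i \<noteq> 0} \<subseteq> A \<Longrightarrow> c00_embed e x = (\<Sum>i\<in>A. x i *\<^sub>R e i)"
  unfolding c00_embed_def by (intro sum.mono_neutral_left) auto

lemma c00_embed_lincomb:
  assumes "x \<in> c00" "y \<in> c00"
  shows "(\<lambda>i. a * x i + b * y i) \<in> c00"
    and "c00_embed e (\<lambda>i. a * x i + b * y i) = a *\<^sub>R c00_embed e x + b *\<^sub>R c00_embed e y"
proof -
  let ?A = "{i. x i \<noteq> 0} \<union> {i. y i \<noteq> 0}"
  have fin: "finite ?A" using assms by (auto simp: c00_def)
  have sub: "{i. a * x i + b * y i \<noteq> 0} \<subseteq> ?A" by auto
  show "(\<lambda>i. a * x i + b * y i) \<in> c00"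
    using finite_subset[OF sub fin] assms by (simp add: c00_def)
  have "c00_embed e (\<lambda>i. a * x i + b * y i) = (\<Sum>i\<in>?A. (a * x i + b * y i) *\<^sub>R e i)"
    by (rule c00_embed_eq[OF fin sub])
  also have "\<dots> = a *\<^sub>R (\<Sum>i\<in>?A. x i *\<^sub>R e i) + b *\<^sub>R (\<Sum>i\<in>?A. y i *\<^sub>R e i)"
    by (simp add: scaleR_add_left sum.distrib scaleR_sum_right)
  also have "\<dots> = a *\<^sub>R c00_embed e x + b *\<^sub>R c00_embed e y"
    using c00_embed_eq[OF fin, of x e] c00_embed_eq[OF fin, of y e] by simp
  finally show "c00_embed e (\<lambda>i. a * x i + b * y i) = a *\<^sub>R c00_embed e x + b *\<^sub>R c00_embed e y" .
qed

lemma c00_embed_sum: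
  assumes "finite K" "\<And>k. k \<in> K \<Longrightarrow> u k \<in> c00"
  shows "(\<lambda>i. \<Sum>k\<in>K. a k * u k i) \<in> c00 \<and>
    c00_embed e (\<lambda>i. \<Sum>k\<in>K. a k * u k i) = (\<Sum>k\<in>K. a k *\<^sub>R c00_embed e (u k))"
  using assms
proof (induction K rule: finite_induct)
  case empty
  then show ?case by (simp add: c00_embed_def c00_def)
next
  case (insert k K)
  then show ?case
    using c00_embed_lincomb(1)[of "u k" "\<lambda>i. \<Sum>k\<in>K. a k * u k i" "a k" 1]
      c00_embed_lincomb(2)[of "u k" "\<lambda>i. \<Sum>k\<in>K. a k * u k i" e "a k" 1] by simp
qed

lemma c00_embed_in_span:
  assumes "{i. x i \<noteq> 0} \<subseteq> N"
  shows "c00_embed e x \<in> span (e ` N)"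
  unfolding c00_embed_def using assms by (intro span_sum span_scale span_base imageI) blast

lemma span_eq_c00_embed: "span (e ` {1..}) = c00_embed e ` c00"
proof
  have "subspace (c00_embed e ` c00)"
    unfolding subspace_def
  proof (intro conjI ballI allI)
    have "c00_embed e (\<lambda>_. 0) = 0" "(\<lambda>_. 0) \<in> c00" by (auto simp: c00_embed_def c00_def)
    then show "0 \<in> c00_embed e ` c00" by (metis imageI)
    fix x y a assume "x \<in> c00_embed e ` c00"
    then obtain v where v: "v \<in> c00" "x = c00_embed e v" by auto
    then show "a *\<^sub>R x \<in> c00_embed e ` c00"
      using c00_embed_lincomb(1)[OF v(1) v(1), of a 0] c00_embed_lincomb(2)[OF v(1) v(1), of e a 0] v(2)
      by (intro image_eqI[of _ _ "\<lambda>i. a * v i + 0 * v i"]) simp_all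
    assume "y \<in> c00_embed e ` c00"
    then obtain w where w: "w \<in> c00" "y = c00_embed e w" by auto
    then show "x + y \<in> c00_embed e ` c00"
      using c00_embed_lincomb(1)[OF v(1) w(1), of 1 1] c00_embed_lincomb(2)[OF v(1) w(1), of e 1 1] v(2) w(2)
      by (intro image_eqI[of _ _ "\<lambda>i. 1 * v i + 1 * w i"]) simp_all
  qed
  moreover have "e ` {1..} \<subseteq> c00_embed e ` c00"
  proof
    fix y assume "y \<in> e ` {1..}"
    then obtain i where i: "i \<ge> 1" "y = e i" by auto
    have "{j. indicator {i} j \<noteq> (0::real)} = {i}" by (auto simp: indicator_def)
    then have "indicator {i} \<in> c00" "c00_embed e (indicator {i}) = e i"
      using i by (auto simp: c00_def c00_embed_def)
    then show "y \<in> c00_embed e ` c00" using i by (metis imageI)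
  qed
  ultimately show "span (e ` {1..}) \<subseteq> c00_embed e ` c00" by (rule span_minimal[rotated])
  have "{i. x i \<noteq> 0} \<subseteq> {1..}" if "x \<in> c00" for x
    using that by (auto simp: c00_def Suc_le_eq intro: gr0I)
  then show "c00_embed e ` c00 \<subseteq> span (e ` {1..})" using c00_embed_in_span by blast
qed

lemma completion_norm: "completion_of_c00 p e \<Longrightarrow> x \<in> c00 \<Longrightarrow> norm (c00_embed e x) = p x"
  by (simp add: completion_of_c00_def c00_embed_def)

lemma completion_sum_norm:
  assumes "completion_of_c00 p e" "finite K" "\<And>k. k \<in> K \<Longrightarrow> u k \<in> c00"
  shows "norm (\<Sum>k\<in>K. a k *\<^sub>R c00_embed e (u k)) = p (\<lambda>i. \<Sum>k\<in>K. a k * u k i)"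
proof -
  note s = c00_embed_sum[of K u a e, OF assms(2,3)]
  show ?thesis using completion_norm[OF assms(1) conjunct1[OF s]] s by simp
qed

lemma completion_dense: "completion_of_c00 p e \<Longrightarrow> closure (c00_embed e ` c00) = UNIV"
  unfolding completion_of_c00_def span_eq_c00_embed by blast

section \<open>Coordinate functionals on the completion and failure of reflexivity\<close>

text \<open>A coordinate is 1-Lipschitz on the dense image of \<open>c00\<close> and extends by
  uniform continuity. The extension is merely a continuous function, so linearity and the norm bound
  are recovered by passing to limits.\<close>

lemma ex_coordinate_functional:
  fixes e :: "nat \<Rightarrow> 'b::banach"
  assumes compl: "completion_of_c00 p e" and coord: "\<And>x. x \<in> c00 \<Longrightarrow> \<bar>x i\<bar> \<le> p x"
  shows "\<exists>f :: 'b \<Rightarrow>\<^sub>L real. \<forall>x\<in>c00. blinfun_apply f (c00_embed e x) = x i"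
proof -
  define V where "V = c00_embed e ` c00"
  have dense: "closure V = UNIV" using completion_dense[OF compl] by (simp add: V_def)
  have diff: "\<bar>x i - y i\<bar> \<le> norm (c00_embed e x - c00_embed e y)" if "x \<in> c00" "y \<in> c00" for x y
    using coord[OF c00_embed_lincomb(1)[OF that, of 1 "-1"]]
      completion_norm[OF compl c00_embed_lincomb(1)[OF that, of 1 "-1"]]
      c00_embed_lincomb(2)[OF that, of e 1 "-1"]
    by simp
  \<comment> \<open>Well defined because preimages of the same vector share their
    \<open>i\<close>-th coordinate, by the Lipschitz estimate.\<close>
  define h where "h v = inv_into c00 (c00_embed e) v i" for v
  have inj: "x i = y i" if "x \<in> c00" "y \<in> c00" "c00_embed e x = c00_embed e y" for x y
    using diff[OF that(1,2)] that(3) by simp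
  have h: "h (c00_embed e x) = x i" if "x \<in> c00" for x
    unfolding h_def using inj[OF _ that] that
    by (metis f_inv_into_f imageI inv_into_into)
  have "uniformly_continuous_on V h"
    unfolding uniformly_continuous_on_def
  proof (intro allI impI)
    fix r :: real assume "0 < r"
    have "dist (h v) (h w) \<le> dist v w" if "v \<in> V" "w \<in> V" for v w
      using that diff h by (auto simp: V_def dist_norm)
    then show "\<exists>d>0. \<forall>x\<in>V. \<forall>x'\<in>V. dist x' x < d \<longrightarrow> dist (h x') (h x) < r"
      using \<open>0 < r\<close> by (meson le_less_trans)
  qed
  then obtain g where "uniformly_continuous_on (closure V) g" and g: "\<And>v. v \<in> V \<Longrightarrow> h v = g v"
    by (rule uniformly_continuous_on_extension_on_closure) blast
  then have cont: "continuous_on UNIV g"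
    using dense uniformly_continuous_imp_continuous by metis
  have g_embed: "g (c00_embed e x) = x i" if "x \<in> c00" for x
    using g[of "c00_embed e x"] h that by (simp add: V_def)
  have approx: "\<exists>x. (\<forall>n. x n \<in> c00) \<and> (\<lambda>n. c00_embed e (x n)) \<longlonglongrightarrow> v" for v
  proof -
    have "v \<in> closure V" using dense by simp
    then obtain y where y: "\<And>n. y n \<in> V" "y \<longlonglongrightarrow> v" unfolding closure_sequential by blast
    then obtain x where "\<And>n. x n \<in> c00" "\<And>n. y n = c00_embed e (x n)"
      unfolding V_def image_iff by metis
    then show ?thesis using y by (metis (no_types, lifting) ext)
  qed
  have g_lim: "(\<lambda>n. x n i) \<longlonglongrightarrow> g v" if "\<And>n. x n \<in> c00" "(\<lambda>n. c00_embed e (x n)) \<longlonglongrightarrow> v" for x v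
    using continuous_on_tendsto_compose[OF cont that(2)] g_embed[OF that(1)] by simp
  have lincomb: "g (a *\<^sub>R v + b *\<^sub>R w) = a * g v + b * g w" for a b v w
  proof -
    obtain x y where x: "\<And>n. x n \<in> c00" "(\<lambda>n. c00_embed e (x n)) \<longlonglongrightarrow> v"
      and y: "\<And>n. y n \<in> c00" "(\<lambda>n. c00_embed e (y n)) \<longlonglongrightarrow> w"
      using approx by metis
    have "(\<lambda>n. a * x n i + b * y n i) \<longlonglongrightarrow> g (a *\<^sub>R v + b *\<^sub>R w)"
    proof (rule g_lim)
      show "(\<lambda>i. a * x n i + b * y n i) \<in> c00" for n by (intro c00_embed_lincomb x y)
      show "(\<lambda>n. c00_embed e (\<lambda>i. a * x n i + b * y n i)) \<longlonglongrightarrow> a *\<^sub>R v + b *\<^sub>R w"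
        unfolding c00_embed_lincomb(2)[OF x(1) y(1)] by (intro tendsto_intros x y)
    qed
    moreover have "(\<lambda>n. a * x n i + b * y n i) \<longlonglongrightarrow> a * g v + b * g w"
      by (intro tendsto_intros g_lim x y)
    ultimately show ?thesis by (rule LIMSEQ_unique)
  qed
  have "norm (g v) \<le> norm v * 1" for v
  proof -
    obtain x where x: "\<And>n. x n \<in> c00" "(\<lambda>n. c00_embed e (x n)) \<longlonglongrightarrow> v" using approx by metis
    have "\<bar>g v\<bar> \<le> norm v"
    proof (rule LIMSEQ_le[OF tendsto_rabs[OF g_lim[OF x]] tendsto_norm[OF x(2)]])
      show "\<exists>N. \<forall>n\<ge>N. \<bar>x n i\<bar> \<le> norm (c00_embed e (x n))"
        using coord[OF x(1)] completion_norm[OF compl x(1)] by simp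
    qed
    then show ?thesis by simp
  qed
  then have "bounded_linear g"
    using lincomb[of 1 _ 1] lincomb[of _ _ 0] by (intro bounded_linear_intro[of g 1]) simp_all
  then have "\<forall>x\<in>c00. blinfun_apply (Blinfun g) (c00_embed e x) = x i"
    using g_embed by (simp add: bounded_linear_Blinfun_apply)
  then show ?thesis by blast
qed

text \<open>The functional \<open>f \<mapsto> \<Sum>k. f (U k)\<close> on the dual is not an evaluation, as the coordinates of a
  representing vector would not tend to zero blockwise.\<close>

proposition not_reflexive_if_c0_blocks:
  fixes e :: "nat \<Rightarrow> 'b::banach"
  assumes compl: "completion_of_c00 p e"
    and coord: "\<And>x i. x \<in> c00 \<Longrightarrow> \<bar>x i\<bar> \<le> p x"
    and restr: "\<And>x k. x \<in> c00 \<Longrightarrow> p (restr x {q k<..q (Suc k)}) \<le> p x"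
    and q: "strict_mono q"
    and supp: "\<And>k. {i. u k i \<noteq> 0} \<subseteq> {q k<..q (Suc k)}" and one: "\<And>k. p (u k) = 1"
    and upper: "\<And>a K M. 0 \<le> M \<Longrightarrow> (\<And>k. k < K \<Longrightarrow> \<bar>a k\<bar> \<le> M) \<Longrightarrow>
      p (\<lambda>i. \<Sum>k<K. a k * u k i) \<le> C * M"
  shows "\<not> reflexive_space TYPE('b)"
proof
  assume refl: "reflexive_space TYPE('b)"
  have u: "u k \<in> c00" for k
    using finite_subset[OF supp[of k]] supp[of k] by (auto simp: c00_def)
  define U where "U k = c00_embed e (u k)" for k
  have bound: "norm (\<Sum>k<K. a k *\<^sub>R U k) \<le> C * M"
    if "0 \<le> M" "\<And>k. k < K \<Longrightarrow> \<bar>a k\<bar> \<le> M" for a K M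
    using upper[OF that] completion_sum_norm[OF compl finite_lessThan u] by (simp add: U_def)
  have C: "0 \<le> C" using bound[of 1 0 "\<lambda>_. 0"] by simp
  \<comment> \<open>Testing \<open>f\<close> on the sum with matching signs turns the upper c_0
    estimate into absolute summability, with a bound linear in \<open>norm f\<close>.\<close>
  have partial: "(\<Sum>k<K. \<bar>blinfun_apply f (U k)\<bar>) \<le> C * norm f" for f :: "'b \<Rightarrow>\<^sub>L real" and K
  proof -
    have "(\<Sum>k<K. \<bar>blinfun_apply f (U k)\<bar>) = blinfun_apply f (\<Sum>k<K. sgn (blinfun_apply f (U k)) *\<^sub>R U k)"
      by (simp add: blinfun.sum_right blinfun.scaleR_right abs_sgn mult.commute)
    also have "\<dots> \<le> norm f * norm (\<Sum>k<K. sgn (blinfun_apply f (U k)) *\<^sub>R U k)"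
      using norm_blinfun[of f] by (metis abs_le_D1 real_norm_def)
    also have "\<dots> \<le> norm f * (C * 1)"
      by (intro mult_left_mono bound) (auto simp: abs_sgn_eq)
    finally show ?thesis by (simp add: mult.commute)
  qed
  have summable: "summable (\<lambda>k. \<bar>blinfun_apply f (U k)\<bar>)" for f :: "'b \<Rightarrow>\<^sub>L real"
    by (rule summableI_nonneg_bounded[OF _ partial]) simp
  note summable' = summable_rabs_cancel[OF summable]
  define F where "F f = (\<Sum>k. blinfun_apply f (U k))" for f :: "'b \<Rightarrow>\<^sub>L real"
  have "bounded_linear F"
  proof (rule bounded_linear_intro)
    show "F (f + g) = F f + F g" for f g
      unfolding F_def using suminf_add[OF summable'[of f] summable'[of g]]
      by (simp add: blinfun.add_left)
    show "F (a *\<^sub>R f) = a *\<^sub>R F f" for a f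
      unfolding F_def using suminf_mult[OF summable'[of f], of a] by (simp add: blinfun.scaleR_left)
    show "norm (F f) \<le> norm f * C" for f
    proof -
      have "\<bar>F f\<bar> \<le> (\<Sum>k. \<bar>blinfun_apply f (U k)\<bar>)" unfolding F_def by (rule summable_rabs[OF summable])
      also have "\<dots> \<le> C * norm f" using partial by (intro suminf_le_const[OF summable])
      finally show ?thesis by (simp add: mult.commute)
    qed
  qed
  then have F: "blinfun_apply (Blinfun F) f = F f" for f by (simp add: bounded_linear_Blinfun_apply)
  obtain x :: 'b where x: "canonical_embedding x = Blinfun F"
    using refl unfolding reflexive_space_def surj_def by metis
  have x_eval: "blinfun_apply f x = F f" for f
    using F[of f] canonical_embedding_apply[of x f] by (simp add: x)
  have "\<forall>i. \<exists>f :: 'b \<Rightarrow>\<^sub>L real. \<forall>x\<in>c00. blinfun_apply f (c00_embed e x) = x i"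
    using ex_coordinate_functional[OF compl coord] by blast
  then obtain g :: "nat \<Rightarrow> 'b \<Rightarrow>\<^sub>L real"
    where g: "\<And>i x. x \<in> c00 \<Longrightarrow> blinfun_apply (g i) (c00_embed e x) = x i" by metis
  have q_mono: "i \<le> j \<Longrightarrow> q i \<le> q j" for i j
    using q by (simp add: strict_mono_less_eq)
  have gx: "blinfun_apply (g i) x = u j i" if "i \<in> {q j<..q (Suc j)}" for i j
  proof -
    have "u k i = 0" if "k \<noteq> j" for k
    proof (rule ccontr)
      assume "u k i \<noteq> 0"
      then have "q k < i" "i \<le> q (Suc k)" using supp[of k] by auto
      then show False
        using \<open>i \<in> _\<close> q_mono[of "Suc k" j] q_mono[of "Suc j" k] that by (auto simp: not_less_eq_eq neq_iff)
    qed
    then have "(\<Sum>k. u k i) = (\<Sum>k\<in>{j}. u k i)" by (intro suminf_finite) auto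
    then show ?thesis by (simp add: x_eval F_def U_def g[OF u])
  qed
  have "x \<in> closure (c00_embed e ` c00)" using completion_dense[OF compl] by simp
  then obtain z where "z \<in> c00_embed e ` c00" "dist z x < 1" unfolding closure_approachable by (metis zero_less_one)
  then obtain y where y: "y \<in> c00" "dist (c00_embed e y) x < 1" by auto
  \<comment> \<open>The finitely supported approximant vanishes beyond \<open>j\<close>, hence
    beyond \<open>q j\<close>, so it contributes nothing on the \<open>j\<close>-th
    interval.\<close>
  define j where "j = Max (insert 0 {i. y i \<noteq> 0})"
  have y_zero: "y i = 0" if "q j < i" for i
  proof (rule ccontr)
    assume "y i \<noteq> 0"
    then have "i \<le> j" using y(1) unfolding j_def by (intro Max_ge) (auto simp: c00_def)
    then show False using that strict_mono_imp_increasing[OF q, of j] by simp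
  qed
  define I where "I = {q j<..q (Suc j)}"
  \<comment> \<open>The projection onto the interval, carried to the completion by the coordinate
    functionals. It is contractive by density, yet sends a vector of norm below 1 to
    \<open>U j\<close>, which has norm 1.\<close>
  define P where "P z = (\<Sum>i\<in>I. blinfun_apply (g i) z *\<^sub>R e i)" for z
  have "norm (P z) \<le> norm z" for z
  proof -
    have "c00_embed e ` c00 \<subseteq> {z. norm (P z) \<le> norm z}"
    proof
      fix z assume "z \<in> c00_embed e ` c00"
      then obtain w where w: "w \<in> c00" "z = c00_embed e w" by auto
      have r: "restr w I \<in> c00"
        using finite_subset[of "{i. restr w I i \<noteq> 0}" "{i. w i \<noteq> 0}"] w(1)
        unfolding c00_def restr_def by (simp add: subset_iff)
      have "P z = (\<Sum>i\<in>I. restr w I i *\<^sub>R e i)"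
        unfolding P_def by (intro sum.cong) (auto simp: w g restr_def)
      also have "\<dots> = c00_embed e (restr w I)"
        by (rule c00_embed_eq[symmetric]) (auto simp: I_def restr_def)
      finally have "norm (P z) = p (restr w I)" using completion_norm[OF compl r] by simp
      then show "z \<in> {z. norm (P z) \<le> norm z}"
        using restr[OF w(1), of j] completion_norm[OF compl w(1)] by (simp add: I_def w(2))
    qed
    moreover have "closed {z. norm (P z) \<le> norm z}"
      unfolding P_def by (intro closed_Collect_le continuous_intros)
    ultimately have "closure (c00_embed e ` c00) \<subseteq> {z. norm (P z) \<le> norm z}"
      by (rule closure_minimal)
    then show ?thesis using completion_dense[OF compl] by auto
  qed
  then have "norm (P (x - c00_embed e y)) \<le> norm (x - c00_embed e y)" .
  moreover have "P (x - c00_embed e y) = (\<Sum>i\<in>I. u j i *\<^sub>R e i)"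
    unfolding P_def by (intro sum.cong) (auto simp: blinfun.diff_right gx g[OF y(1)] y_zero I_def)
  then have "P (x - c00_embed e y) = U j"
    using c00_embed_eq[of I "u j" e] supp[of j] by (simp add: U_def I_def)
  then have "norm (P (x - c00_embed e y)) = 1" using completion_norm[OF compl u] one by (simp add: U_def)
  ultimately show False using y(2) by (simp add: dist_norm norm_minus_commute)
qed

theorem corollary2p4p8:
  fixes m n \<gamma> :: "nat \<Rightarrow> nat"
    and D :: "nat set"
    and le :: "nat \<Rightarrow> nat \<Rightarrow> bool"
    and e :: "nat \<Rightarrow> 'b::banach"
  assumes "jt_tree m n \<gamma> D le"
    and "completion_of_c00 (jt_tree.jt_norm m n \<gamma> D le) e"
  shows "\<not> reflexive_space TYPE('b) \<and>
    (\<forall>N. N \<subseteq> {1..} \<and> infinite N \<longrightarrow>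
       (\<exists>Y. subspace Y \<and> closed Y \<and> Y \<subseteq> closure (span (e ` N)) \<and>
          isomorphic_subspaces c0 Y))"
proof (intro conjI allI impI)
  interpret jt_tree m n \<gamma> D le by (rule assms(1))
  note compl = assms(2)
  have fin: "finite {i. x i \<noteq> 0}" if "x \<in> c00" for x using that by (simp add: c00_def)
  have coord: "\<bar>x i\<bar> \<le> jt_norm x" if "x \<in> c00" for x i
    by (rule abs_le_jt_norm[OF fin[OF that]])
  have restr: "jt_norm (restr x {a<..b}) \<le> jt_norm x" if "x \<in> c00" for x a b
    by (rule jt_norm_restr_le[OF fin[OF that]]) (auto simp: nat_interval_def)
  {
    have "infinite {1::nat..}" by (rule infinite_Ici)
    then obtain u q C where "c0_blocks {1..} u q C" using ex_c0_blocks[OF _ subset_refl] by blast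
    then have q: "strict_mono q"
      and supp: "\<And>k. {i. u k i \<noteq> 0} \<subseteq> {q k<..q (Suc k)}" and one: "\<And>k. jt_norm (u k) = 1"
      and upper: "\<And>a K M. 0 \<le> M \<Longrightarrow> (\<And>k. k < K \<Longrightarrow> \<bar>a k\<bar> \<le> M) \<Longrightarrow>
        jt_norm (\<lambda>i. \<Sum>k<K. a k * u k i) \<le> C * M"
      unfolding c0_blocks_def by blast+
    show "\<not> reflexive_space TYPE('b)"
      by (rule not_reflexive_if_c0_blocks[OF compl coord restr q supp one upper])
  }
  fix N :: "nat set" assume "N \<subseteq> {1..} \<and> infinite N"
  then obtain u q C where "c0_blocks N u q C" using ex_c0_blocks by blast
  then have q: "strict_mono q"
    and supp: "\<And>k. {i. u k i \<noteq> 0} \<subseteq> N \<inter> {q k<..q (Suc k)}" and one: "\<And>k. jt_norm (u k) = 1"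
    and upper: "\<And>a K M. 0 \<le> M \<Longrightarrow> (\<And>k. k < K \<Longrightarrow> \<bar>a k\<bar> \<le> M) \<Longrightarrow>
      jt_norm (\<lambda>i. \<Sum>k<K. a k * u k i) \<le> C * M"
    unfolding c0_blocks_def by blast+
  have u: "u k \<in> c00" for k
    using finite_subset[OF supp[of k]] supp[of k] by (auto simp: c00_def)
  have q_mono: "i \<le> j \<Longrightarrow> q i \<le> q j" for i j using q by (simp add: strict_mono_less_eq)
  show "\<exists>Y. subspace Y \<and> closed Y \<and> Y \<subseteq> closure (span (e ` N)) \<and> isomorphic_subspaces c0 Y"
  proof (rule c0_isomorphic_subspace[of "\<lambda>k. c00_embed e (u k)"])
    show "norm (\<Sum>k<K. a k *\<^sub>R c00_embed e (u k)) \<le> C * M"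
      if "0 \<le> M" "\<And>k. k < K \<Longrightarrow> \<bar>a k\<bar> \<le> M" for a K M
      using upper[OF that] completion_sum_norm[OF compl finite_lessThan u] by simp
    \<comment> \<open>Restricting the sum to the \<open>j\<close>-th interval leaves
      \<open>a j\<close> times a normalised block, and interval restriction is contractive.\<close>
    show "\<bar>a j\<bar> \<le> norm (\<Sum>k<K. a k *\<^sub>R c00_embed e (u k))" if "j < K" for a K j
    proof -
      define x where "x = (\<lambda>i. \<Sum>k<K. a k * u k i)"
      have x: "x \<in> c00" using c00_embed_sum[of "{..<K}" u a e] u by (simp add: x_def)
      have "\<bar>a j\<bar> = norm (\<Sum>k\<in>{j}. a k *\<^sub>R c00_embed e (u k))"
        using completion_norm[OF compl u] one by simp
      also have "\<dots> = jt_norm (\<lambda>i. \<Sum>k\<in>{j}. a k * u k i)"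
        by (rule completion_sum_norm[OF compl _ u]) simp
      also have "(\<lambda>i. \<Sum>k\<in>{j}. a k * u k i) = restr x {q j<..q (Suc j)}"
      proof
        fix i
        show "(\<Sum>k\<in>{j}. a k * u k i) = restr x {q j<..q (Suc j)} i"
        proof (cases "i \<in> {q j<..q (Suc j)}")
          case True
          have "u k i = 0" if "k \<noteq> j" for k
          proof (rule ccontr)
            assume "u k i \<noteq> 0"
            then have "q k < i" "i \<le> q (Suc k)" using supp[of k] by auto
            then show False
              using True q_mono[of "Suc k" j] q_mono[of "Suc j" k] that by (auto simp: neq_iff)
          qed
          then have "x i = (\<Sum>k\<in>{j}. a k * u k i)"
            unfolding x_def using \<open>j < K\<close> by (intro sum.mono_neutral_right) auto
          then show ?thesis using True by (simp add: restr_def)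
        next
          case False
          then have "u j i = 0" using supp[of j] by auto
          then show ?thesis using False by (auto simp: restr_def)
        qed
      qed
      also have "jt_norm \<dots> \<le> jt_norm x" by (rule restr[OF x])
      also have "\<dots> = norm (\<Sum>k<K. a k *\<^sub>R c00_embed e (u k))"
        unfolding x_def by (rule completion_sum_norm[OF compl finite_lessThan u, symmetric])
      finally show ?thesis .
    qed
    show "(\<Sum>k<K. a k *\<^sub>R c00_embed e (u k)) \<in> closure (span (e ` N))" for a K
    proof (rule subsetD[OF closure_subset])
      show "(\<Sum>k<K. a k *\<^sub>R c00_embed e (u k)) \<in> span (e ` N)"
        using supp by (intro span_sum span_scale c00_embed_in_span) blast
    qed
  qed simp
qed

end
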